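(* Assume that $\omega_1$ is a precaliber of measure algebras. Let $K$ be a compact zerodimensional space, let $\mu$ be a non-separable measure on $K$, and let $f\colon K\to 2^\omega$ be a continuous mapping. Then there is $t\in 2^\omega$ such that the fiber $f^{-1}(t)=f^{-1}[\{t\}]$ carries a non-separable measure.
   Context: All spaces are Hausdorff. A measure on a compact space means a Radon probability measure on its Borel sets. A family $\mathcal{E}$ of measurable sets approximates $\mu$ if $\inf\{\mu(A\triangle E)\colon E\in\mathcal{E}\}=0$ for every $\mu$-measurable $A$; the Maharam type of $\mu$ is the minimal size of a family approximating $\mu$, and $\mu$ is separable if its Maharam type is at most $\omega$ (non-separable otherwise). A space $L$ carries a measure if there is a measure on $L$ (not necessarily strictly positive). $\omega_1$ is a precaliber of a Boolean algebra $\mathfrak{A}$ if every uncountable family of nonzero elements of $\mathfrak{A}$ has an uncountable centered subfamily (every finite subfamily has nonzero meet); "$\omega_1$ is a precaliber of measure algebras" means this holds for the measure algebra (Borel sets modulo null sets) of every probability measure. (This is equivalent to $\mathsf{MA}_{\omega_1}$ for measure algebras and to $\mathrm{cov}(\mathcal{N}_{\omega_1})>\omega_1$.) *)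

theory Defs
  imports
    "HOL-Algebra.Lattice"
    "HOL-Library.Countable_Set_Type"
    "HOL-Probability.Probability_Measure"
begin

definition radon_prob :: "'a topology \<Rightarrow> 'a measure \<Rightarrow> bool" where
  "radon_prob X M \<longleftrightarrow>
     prob_space M \<and>
     space M = topspace X \<and>
     sets M = sigma_sets (topspace X) {U. openin X U} \<and>
     (\<forall>A\<in>sets M. emeasure M A = (SUP C\<in>{C. compactin X C \<and> C \<subseteq> A}. emeasure M C))"

text \<open>The measurable sets of a measure are those of its completion. The infimum is taken in
  \<^typ>\<open>ennreal\<close>, so the empty family approximates nothing.\<close>

definition approximates :: "'a set set \<Rightarrow> 'a measure \<Rightarrow> bool" where
  "approximates \<E> M \<longleftrightarrow>
     \<E> \<subseteq> sets (completion M) \<and>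
     (\<forall>A\<in>sets (completion M). (INF E\<in>\<E>. emeasure (completion M) (sym_diff A E)) = 0)"

context
  includes cardinal_syntax
begin

definition maharam_type :: "'a measure \<Rightarrow> 'a set rel" where
  "maharam_type M =
     |SOME \<E>. approximates \<E> M \<and> (\<forall>\<E>'. approximates \<E>' M \<longrightarrow> |\<E>| \<le>o |\<E>'| )|"

definition separable_measure :: "'a measure \<Rightarrow> bool" where
  "separable_measure M \<longleftrightarrow> maharam_type M \<le>o natLeq"

lemma approximates_sets_completion: "approximates (sets (completion M)) M"
  unfolding approximates_def
proof (intro conjI ballI)
  fix A assume A: "A \<in> sets (completion M)"
  have "(INF E\<in>sets (completion M). emeasure (completion M) (sym_diff A E))
          \<le> emeasure (completion M) (sym_diff A A)"
    by (rule INF_lower[OF A])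
  then show "(INF E\<in>sets (completion M). emeasure (completion M) (sym_diff A E)) = 0"
    by simp
qed simp

lemma maharam_type_minimal:
  obtains \<E> where "approximates \<E> M" "maharam_type M = |\<E>|"
    "\<And>\<E>'. approximates \<E>' M \<Longrightarrow> |\<E>| \<le>o |\<E>'|"
proof -
  let ?R = "{|\<E>| | \<E>. approximates \<E> M}"
  have "\<exists>r\<in>?R. \<forall>r'\<in>?R. r \<le>o r'"
    by (rule exists_minim_Card_order) (use approximates_sets_completion card_of_Card_order in blast)+
  then have "\<exists>\<E>. approximates \<E> M \<and> (\<forall>\<E>'. approximates \<E>' M \<longrightarrow> |\<E>| \<le>o |\<E>'| )"
    by blast
  from someI_ex[OF this] show thesis
    using that unfolding maharam_type_def by blast
qed

lemma separable_measure_iff: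
  "separable_measure M \<longleftrightarrow> (\<exists>\<E>. countable \<E> \<and> approximates \<E> M)"
proof -
  have c: "countable A \<longleftrightarrow> |A| \<le>o natLeq" for A :: "'a set set"
    by (metis countable_card_of_nat card_of_nat ordLeq_ordIso_trans ordIso_symmetric)
  obtain \<E> where "approximates \<E> M" "maharam_type M = |\<E>|"
    "\<And>\<E>'. approximates \<E>' M \<Longrightarrow> |\<E>| \<le>o |\<E>'|"
    by (rule maharam_type_minimal[of M]) blast
  then show ?thesis
    unfolding separable_measure_def c using ordLeq_transitive by metis
qed

end

definition carries_nonseparable_measure :: "'a topology \<Rightarrow> bool" where
  "carries_nonseparable_measure X \<longleftrightarrow> (\<exists>M. radon_prob X M \<and> \<not> separable_measure M)"

definition null_eq :: "'a measure \<Rightarrow> 'a set rel" where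
  "null_eq M = {(A, B). A \<in> sets M \<and> B \<in> sets M \<and> sym_diff A B \<in> null_sets M}"

definition measure_algebra :: "'a measure \<Rightarrow> 'a set set gorder" where
  "measure_algebra M =
     \<lparr>carrier = sets M // null_eq M, eq = (=),
      le = (\<lambda>a b. \<exists>A\<in>a. \<exists>B\<in>b. A - B \<in> null_sets M)\<rparr>"

definition centered :: "('b, 'c) gorder_scheme \<Rightarrow> 'b set \<Rightarrow> bool" where
  "centered L G \<longleftrightarrow> (\<forall>H. H \<subseteq> G \<and> finite H \<and> H \<noteq> {} \<longrightarrow> \<Sqinter>\<^bsub>L\<^esub>H \<noteq> \<bottom>\<^bsub>L\<^esub>)"

definition omega1_precaliber :: "('b, 'c) gorder_scheme \<Rightarrow> bool" where
  "omega1_precaliber L \<longleftrightarrow>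
     (\<forall>F. F \<subseteq> carrier L - {\<bottom>\<^bsub>L\<^esub>} \<and> uncountable F \<longrightarrow>
        (\<exists>G. G \<subseteq> F \<and> uncountable G \<and> centered L G))"

abbreviation null_class :: "'a measure \<Rightarrow> 'a set \<Rightarrow> 'a set set" where
  "null_class M A \<equiv> null_eq M `` {A}"

lemma equiv_null_eq: "equiv (sets M) (null_eq M)"
proof (rule equivI)
  show "null_eq M \<subseteq> sets M \<times> sets M" "refl_on (sets M) (null_eq M)" "sym (null_eq M)"
    by (auto simp: null_eq_def refl_on_def sym_def Un_commute)
  show "trans (null_eq M)"
  proof (rule transI)
    fix A B C assume "(A, B) \<in> null_eq M" "(B, C) \<in> null_eq M"
    then have *: "A \<in> sets M" "C \<in> sets M" "sym_diff A B \<union> sym_diff B C \<in> null_sets M"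
      unfolding null_eq_def by (blast intro: null_sets.Un)+
    have "sym_diff A C \<in> null_sets M"
      by (rule null_sets_subset[OF *(3)]) (use * in auto)
    with * show "(A, C) \<in> null_eq M"
      by (auto simp: null_eq_def)
  qed
qed

lemma carrier_measure_algebra: "carrier (measure_algebra M) = null_class M ` sets M"
  by (auto simp: measure_algebra_def quotient_def)

lemma null_class_le_iff:
  assumes "A \<in> sets M" "B \<in> sets M"
  shows "null_class M A \<sqsubseteq>\<^bsub>measure_algebra M\<^esub> null_class M B \<longleftrightarrow> A - B \<in> null_sets M"
proof
  assume "null_class M A \<sqsubseteq>\<^bsub>measure_algebra M\<^esub> null_class M B"
  then obtain A' B' where *: "(A, A') \<in> null_eq M" "(B, B') \<in> null_eq M" "A' - B' \<in> null_sets M"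
    by (auto simp: measure_algebra_def)
  then have "sym_diff A A' \<union> sym_diff B B' \<union> (A' - B') \<in> null_sets M"
    unfolding null_eq_def by (blast intro: null_sets.Un)
  then show "A - B \<in> null_sets M"
    by (rule null_sets_subset) (use assms in auto)
next
  assume "A - B \<in> null_sets M"
  moreover have "A \<in> null_class M A" "B \<in> null_class M B"
    using assms by (auto simp: null_eq_def)
  ultimately show "null_class M A \<sqsubseteq>\<^bsub>measure_algebra M\<^esub> null_class M B"
    by (auto simp: measure_algebra_def)
qed

lemma null_class_eq_iff:
  assumes "A \<in> sets M" "B \<in> sets M"
  shows "null_class M A = null_class M B \<longleftrightarrow> sym_diff A B \<in> null_sets M"
  using assms eq_equiv_class_iff[OF equiv_null_eq assms] by (auto simp: null_eq_def)

lemma partial_order_measure_algebra: "partial_order (measure_algebra M)"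
proof
  show "(.=\<^bsub>measure_algebra M\<^esub>) = (=)"
    by (simp add: measure_algebra_def)
  fix x y z
  assume "x \<in> carrier (measure_algebra M)" "y \<in> carrier (measure_algebra M)"
    "z \<in> carrier (measure_algebra M)"
    and le: "x \<sqsubseteq>\<^bsub>measure_algebra M\<^esub> y" "y \<sqsubseteq>\<^bsub>measure_algebra M\<^esub> z"
  then obtain A B C where *: "A \<in> sets M" "B \<in> sets M" "C \<in> sets M"
    "x = null_class M A" "y = null_class M B" "z = null_class M C"
    by (auto simp: carrier_measure_algebra)
  then have "(A - B) \<union> (B - C) \<in> null_sets M"
    using le by (auto simp: null_class_le_iff)
  then have "A - C \<in> null_sets M"
    by (rule null_sets_subset) (use * in auto)
  with * show "x \<sqsubseteq>\<^bsub>measure_algebra M\<^esub> z"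
    by (simp add: null_class_le_iff)
next
  fix x y
  assume "x \<in> carrier (measure_algebra M)" "y \<in> carrier (measure_algebra M)"
    and le: "x \<sqsubseteq>\<^bsub>measure_algebra M\<^esub> y" "y \<sqsubseteq>\<^bsub>measure_algebra M\<^esub> x"
  then obtain A B where *: "A \<in> sets M" "B \<in> sets M" "x = null_class M A" "y = null_class M B"
    by (auto simp: carrier_measure_algebra)
  with le have "sym_diff A B \<in> null_sets M"
    by (auto simp: null_class_le_iff)
  with * show "x .=\<^bsub>measure_algebra M\<^esub> y"
    by (simp add: null_class_eq_iff measure_algebra_def)
next
  fix x assume "x \<in> carrier (measure_algebra M)"
  then show "x \<sqsubseteq>\<^bsub>measure_algebra M\<^esub> x"
    by (auto simp: carrier_measure_algebra null_class_le_iff)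
qed (auto simp: measure_algebra_def)

lemma greatest_unique_measure_algebra:
  assumes "greatest (measure_algebra M) x S" "greatest (measure_algebra M) y S"
  shows "x = y"
  using assms partial_order.le_antisym[OF partial_order_measure_algebra]
  unfolding greatest_def by blast

lemma bottom_measure_algebra: "\<bottom>\<^bsub>measure_algebra M\<^esub> = null_class M {}"
proof -
  have "least (measure_algebra M) (null_class M {}) (carrier (measure_algebra M))"
    by (auto simp: least_def carrier_measure_algebra null_class_le_iff)
  moreover have "x = y" if "least (measure_algebra M) x (carrier (measure_algebra M))"
    "least (measure_algebra M) y (carrier (measure_algebra M))" for x y
    using that partial_order.le_antisym[OF partial_order_measure_algebra]
    unfolding least_def by blast
  ultimately show ?thesis
    unfolding bottom_def by (metis someI)
qed

lemma Inf_measure_algebra: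
  assumes "finite \<A>" "\<A> \<noteq> {}" "\<A> \<subseteq> sets M"
  shows "\<Sqinter>\<^bsub>measure_algebra M\<^esub>(null_class M ` \<A>) = null_class M (\<Inter>\<A>)"
proof -
  have I: "\<Inter>\<A> \<in> sets M"
    using sets.finite_INT[of \<A> "\<lambda>A. A" M] assms by auto
  let ?L = "Lower (measure_algebra M) (null_class M ` \<A>)"
  have "greatest (measure_algebra M) (null_class M (\<Inter>\<A>)) ?L"
    unfolding greatest_def
  proof (intro conjI ballI)
    show "?L \<subseteq> carrier (measure_algebra M)"
      by (auto simp: Lower_def)
    have "null_class M (\<Inter>\<A>) \<sqsubseteq>\<^bsub>measure_algebra M\<^esub> null_class M A" if "A \<in> \<A>" for A
    proof -
      have "A \<in> sets M" "\<Inter>\<A> - A = {}"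
        using that assms by auto
      then show ?thesis
        by (simp only: null_class_le_iff[OF I] null_sets.empty_sets)
    qed
    then show "null_class M (\<Inter>\<A>) \<in> ?L"
      using I unfolding Lower_def carrier_measure_algebra by blast
    fix x assume x: "x \<in> ?L"
    then obtain B where B: "B \<in> sets M" "x = null_class M B"
      by (auto simp: Lower_def carrier_measure_algebra)
    have "B - A \<in> null_sets M" if "A \<in> \<A>" for A
    proof -
      have "A \<in> sets M" using that assms by auto
      moreover from this have "null_class M A \<in> carrier (measure_algebra M)"
        by (simp add: carrier_measure_algebra)
      ultimately show ?thesis
        using x B that null_class_le_iff[OF B(1), of A] unfolding Lower_def by blast
    qed
    then have "(\<Union>A\<in>\<A>. B - A) \<in> null_sets M"
      using assms by (intro null_sets.finite_UN) auto
    moreover have "(\<Union>A\<in>\<A>. B - A) = B - \<Inter>\<A>"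
      by auto
    ultimately show "x \<sqsubseteq>\<^bsub>measure_algebra M\<^esub> null_class M (\<Inter>\<A>)"
      using B I by (simp add: null_class_le_iff)
  qed
  then show ?thesis
    unfolding Lattice.inf_def by (metis (no_types, lifting) someI greatest_unique_measure_algebra)
qed

lemma centered_measure_algebra_iff:
  assumes "\<G> \<subseteq> sets M"
  shows "centered (measure_algebra M) (null_class M ` \<G>) \<longleftrightarrow>
    (\<forall>\<A>. \<A> \<subseteq> \<G> \<and> finite \<A> \<and> \<A> \<noteq> {} \<longrightarrow> \<Inter>\<A> \<notin> null_sets M)"
proof -
  have *: "\<Sqinter>\<^bsub>measure_algebra M\<^esub>(null_class M ` \<A>) \<noteq> \<bottom>\<^bsub>measure_algebra M\<^esub> \<longleftrightarrow> \<Inter>\<A> \<notin> null_sets M"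
    if "\<A> \<subseteq> \<G>" "finite \<A>" "\<A> \<noteq> {}" for \<A>
  proof -
    have "\<A> \<subseteq> sets M" using that assms by auto
    moreover from this have "\<Inter>\<A> \<in> sets M"
      using sets.finite_INT[of \<A> "\<lambda>A. A" M] that by auto
    ultimately show ?thesis
      using that null_class_eq_iff[of "\<Inter>\<A>" M "{}"]
      by (simp add: Inf_measure_algebra bottom_measure_algebra)
  qed
  show ?thesis
  proof
    assume c: "centered (measure_algebra M) (null_class M ` \<G>)"
    show "\<forall>\<A>. \<A> \<subseteq> \<G> \<and> finite \<A> \<and> \<A> \<noteq> {} \<longrightarrow> \<Inter>\<A> \<notin> null_sets M"
    proof (intro allI impI, elim conjE)
      fix \<A> assume \<A>: "\<A> \<subseteq> \<G>" "finite \<A>" "\<A> \<noteq> {}"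
      then have "null_class M ` \<A> \<subseteq> null_class M ` \<G>" "finite (null_class M ` \<A>)"
        "null_class M ` \<A> \<noteq> {}"
        by auto
      with c have "\<Sqinter>\<^bsub>measure_algebra M\<^esub>(null_class M ` \<A>) \<noteq> \<bottom>\<^bsub>measure_algebra M\<^esub>"
        unfolding centered_def by blast
      with *[OF \<A>] show "\<Inter>\<A> \<notin> null_sets M"
        by blast
    qed
  next
    assume c: "\<forall>\<A>. \<A> \<subseteq> \<G> \<and> finite \<A> \<and> \<A> \<noteq> {} \<longrightarrow> \<Inter>\<A> \<notin> null_sets M"
    show "centered (measure_algebra M) (null_class M ` \<G>)"
      unfolding centered_def
    proof (intro allI impI, elim conjE)
      fix H assume H: "H \<subseteq> null_class M ` \<G>" "finite H" "H \<noteq> {}"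
      then obtain \<A> where \<A>: "\<A> \<subseteq> \<G>" "finite \<A>" "H = null_class M ` \<A>"
        by (meson finite_subset_image)
      with H have "\<A> \<noteq> {}" by auto
      with *[OF \<A>(1,2)] c \<A> show "\<Sqinter>\<^bsub>measure_algebra M\<^esub>H \<noteq> \<bottom>\<^bsub>measure_algebra M\<^esub>"
        by blast
    qed
  qed
qed

text \<open>HOL has no quantification over types inside a formula, so \<open>every measure\<close> has to be read as
  every Radon probability measure on a compact space whose points come from one fixed type. No
  generality is lost if \<^typ>\<open>nat set set\<close> injects into that type. It then has room for the
  Cantor cube of weight \<open>\<omega>\<^sub>1\<close>; and \<open>\<omega>\<^sub>1\<close> many measurable sets \<open>A i\<close> of an arbitrary probability
  space are the preimages of the subbasic clopen sets of that cube under the map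
  \<open>x \<mapsto> (\<lambda>i. x \<in> A i)\<close>, whose image measure extends to a Radon measure on the cube.\<close>

definition omega1_precaliber_measure_algebras :: "'b itself \<Rightarrow> bool" where
  "omega1_precaliber_measure_algebras (_ :: 'b itself) \<longleftrightarrow>
     (\<forall>(X :: 'b topology) M. compact_space X \<and> Hausdorff_space X \<and> radon_prob X M \<longrightarrow>
        omega1_precaliber (measure_algebra M))"

abbreviation cantor_space :: "(nat \<Rightarrow> bool) topology" where
  "cantor_space \<equiv> product_topology (\<lambda>_. discrete_topology UNIV) UNIV"

end

theory Submission
  imports Defs
begin

text \<open>
  Non-separability gives \<open>e > 0\<close> such that every countable family of measurable sets is missed by
  \<open>e\<close> by some clopen set. By recursion over \<open>\<omega>\<^sub>1\<close> choose clopen sets \<open>A i\<close> that are \<open>e\<close>-far from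
  all finite unions of sets \<open>V \<inter> A j\<close>, where \<open>j < i\<close> and \<open>V\<close> is the \<open>f\<close>-preimage of a cylinder of
  \<open>2\<^sup>\<omega>\<close>. Let \<open>B i\<close> be the closed set of all \<open>x\<close> such that \<open>A i\<close> and \<open>A j\<close> differ by more than the
  proportion \<open>e/2\<close> on every cylinder \<open>V\<close> around \<open>x\<close>, for every \<open>j < i\<close>. It has measure at least
  \<open>e/2\<close>: otherwise copying suitable sets \<open>A j\<close> on disjoint cylinders outside \<open>B i\<close> would
  approximate \<open>A i\<close> too well. The precaliber assumption and compactness yield a point \<open>x\<close> lying in
  \<open>B i\<close> for uncountably many \<open>i\<close>. Any cluster point of the normalised restrictions of \<open>\<mu>\<close> to the
  cylinders shrinking to the fiber of \<open>x\<close> is a measure on that fiber for which these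
  uncountably many \<open>A i\<close> remain \<open>e/2\<close>-separated. This replaces a disintegration of \<open>\<mu>\<close> over \<open>f\<close>.
\<close>

subsection \<open>Clopen sets and Radon measures\<close>

abbreviation clopenin :: "'a topology \<Rightarrow> 'a set \<Rightarrow> bool" where
  "clopenin K A \<equiv> openin K A \<and> closedin K A"

text \<open>Zerodimensionality gives each point of \<open>C\<close> a clopen neighbourhood inside
  \<open>U\<close>; compactness of \<open>C\<close> leaves finitely many of them, whose union is
  still closed.\<close>

lemma clopen_between:
  assumes "compact_space K" "K dim_le 0" "closedin K C" "openin K U" "C \<subseteq> U"
  obtains A where "clopenin K A" "C \<subseteq> A" "A \<subseteq> U"
proof -
  let ?\<U> = "{V. clopenin K V \<and> V \<subseteq> U}"
  have "compactin K C"
    using assms closedin_compact_space by blast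
  moreover have "C \<subseteq> \<Union>?\<U>"
  proof
    fix x assume "x \<in> C"
    then have "x \<in> U" using assms by auto
    with assms(2,4) obtain W V where "openin K W" "clopenin K V" "x \<in> W" "W \<subseteq> V" "V \<subseteq> U"
      unfolding dimension_le_0_neighbourhood_base_of_clopen neighbourhood_base_of
      by meson
    then show "x \<in> \<Union>?\<U>" by blast
  qed
  moreover have "\<forall>V\<in>?\<U>. openin K V" by blast
  ultimately obtain \<F> where \<F>: "finite \<F>" "\<F> \<subseteq> ?\<U>" "C \<subseteq> \<Union>\<F>"
    unfolding compactin_def by meson
  show thesis
  proof
    show "clopenin K (\<Union>\<F>)"
      using \<F> by (auto intro!: openin_Union closedin_Union)
  qed (use \<F> in auto)
qed

lemma radon_prob_inner_approximation:
  assumes "radon_prob K M" "S \<in> sets M" "0 < e"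
  obtains C where "compactin K C" "C \<subseteq> S" "measure M S < measure M C + e"
proof -
  interpret prob_space M using assms by (simp add: radon_prob_def)
  show thesis
  \<comment> \<open>\<open>ennreal\<close> truncates negative reals to 0, so
    \<open>measure M S - e\<close> serves as a strict lower bound only when it is nonnegative;
    otherwise the empty set does.\<close>
  proof (cases "measure M S < e")
    case True
    then show thesis using that[of "{}"] by simp
  next
    case False
    have "ennreal (measure M S - e) < emeasure M S"
      using False assms by (simp add: emeasure_eq_measure ennreal_less_iff)
    also have "emeasure M S = (SUP C\<in>{C. compactin K C \<and> C \<subseteq> S}. emeasure M C)"
      using assms by (simp add: radon_prob_def)
    finally obtain C where C: "compactin K C" "C \<subseteq> S" "ennreal (measure M S - e) < emeasure M C"
      by (auto simp: less_SUP_iff)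
    then have "measure M S - e < measure M C"
      using False by (simp add: emeasure_eq_measure ennreal_less_iff)
    then show thesis using that C by simp
  qed
qed

lemma radon_prob_openin_sets: "radon_prob K M \<Longrightarrow> openin K U \<Longrightarrow> U \<in> sets M"
  by (auto simp: radon_prob_def)

lemma radon_prob_closedin_sets:
  assumes "radon_prob K M" "closedin K C"
  shows "C \<in> sets M"
proof -
  have "space M - (topspace K - C) \<in> sets M"
    using assms radon_prob_openin_sets by blast
  moreover have "space M - (topspace K - C) = C"
    using assms closedin_subset by (fastforce simp: radon_prob_def)
  ultimately show ?thesis by simp
qed

text \<open>Inner regularity of both \<open>S\<close> and its complement leaves compact cores
  \<open>C\<close> and \<open>D\<close>. A clopen set between \<open>C\<close> and the complement of
  \<open>D\<close> can go wrong only on the two remainders, each of measure below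
  \<open>e/2\<close>.\<close>

lemma clopen_approximation:
  assumes K: "compact_space K" "Hausdorff_space K" "K dim_le 0"
    and M: "radon_prob K M" and S: "S \<in> sets M" and e: "0 < e"
  obtains A where "clopenin K A" "measure M (sym_diff S A) < e"
proof -
  interpret prob_space M using M by (simp add: radon_prob_def)
  have sp: "space M = topspace K" using M by (simp add: radon_prob_def)
  obtain C where C: "compactin K C" "C \<subseteq> S" "measure M S < measure M C + e/2"
    using radon_prob_inner_approximation[OF M S, of "e/2"] e by auto
  obtain D where D: "compactin K D" "D \<subseteq> space M - S"
      "measure M (space M - S) < measure M D + e/2"
    using radon_prob_inner_approximation[OF M, of "space M - S" "e/2"] e S by auto
  have cl: "closedin K C" "closedin K D"
    using C D K compactin_imp_closedin by blast+
  obtain A where A: "clopenin K A" "C \<subseteq> A" "A \<subseteq> topspace K - D"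
    using clopen_between[OF K(1,3) cl(1), of "topspace K - D"] cl C D closedin_subset[OF cl(1)]
    by blast
  have sets: "A \<in> sets M" "C \<in> sets M" "D \<in> sets M"
    using A cl radon_prob_closedin_sets[OF M] by auto
  have "measure M (sym_diff S A) \<le> measure M ((S - C) \<union> ((space M - S) - D))"
    using A S sets sp[symmetric] by (intro finite_measure_mono) auto
  also have "\<dots> \<le> measure M (S - C) + measure M ((space M - S) - D)"
    using S sets by (intro measure_Un_le) auto
  also have "\<dots> < e/2 + e/2"
    using C D S sets by (subst (1 2) finite_measure_Diff) auto
  finally show thesis using A that by simp
qed

text \<open>Were there no such \<open>e\<close>, each bound 1/(n+1) would have a countable family
  coming within it of every clopen set. The union of these families then approximates all clopen
  sets, hence, by the density of clopen sets, all measurable ones.\<close>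

lemma nonseparable_clopen_far:
  assumes K: "compact_space K" "Hausdorff_space K" "K dim_le 0"
    and M: "radon_prob K M" and ns: "\<not> separable_measure M"
  shows "\<exists>e>0. \<forall>\<E>. countable \<E> \<and> \<E> \<subseteq> sets M \<longrightarrow>
    (\<exists>A. clopenin K A \<and> (\<forall>E\<in>\<E>. e \<le> measure M (sym_diff A E)))"
proof (rule ccontr)
  interpret prob_space M using M by (simp add: radon_prob_def)
  assume "\<not> ?thesis"
  then have "\<exists>\<E>. countable \<E> \<and> \<E> \<subseteq> sets M \<and>
      (\<forall>A. clopenin K A \<longrightarrow> (\<exists>E\<in>\<E>. measure M (sym_diff A E) < e))" if "0 < e" for e
    using that by (meson not_le)
  then have "\<forall>n::nat. \<exists>\<E>. countable \<E> \<and> \<E> \<subseteq> sets M \<and>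
      (\<forall>A. clopenin K A \<longrightarrow> (\<exists>E\<in>\<E>. measure M (sym_diff A E) < inverse (Suc n)))"
    by simp
  then obtain \<E> where \<E>: "\<And>n::nat. countable (\<E> n)" "\<And>n. \<E> n \<subseteq> sets M"
    "\<And>n A. clopenin K A \<Longrightarrow> \<exists>E\<in>\<E> n. measure M (sym_diff A E) < inverse (Suc n)"
    by metis
  have "approximates (\<Union>n. \<E> n) M"
    unfolding approximates_def
  proof (intro conjI ballI)
    show "(\<Union>n. \<E> n) \<subseteq> sets (completion M)"
      using \<E>(2) by (auto simp: subset_eq)
    fix S assume S: "S \<in> sets (completion M)"
    \<comment> \<open>Measurability refers to the completion, whereas clopen approximation works for
      \<open>M\<close>; the main part of \<open>S\<close> lies in \<open>sets M\<close> and differs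
      from \<open>S\<close> by a null set only.\<close>
    let ?S = "main_part M S"
    have S': "?S \<in> sets M" using S by simp
    have le: "(INF E\<in>(\<Union>n. \<E> n). emeasure (completion M) (sym_diff S E)) \<le> ennreal d" if d: "0 < d" for d
    proof -
      obtain n where n: "inverse (real (Suc n)) < d/2"
        using reals_Archimedean[of "d/2"] d by auto
      obtain A where A: "clopenin K A" "measure M (sym_diff ?S A) < d/2"
        using clopen_approximation[OF K M S', of "d/2"] d by auto
      obtain E where E: "E \<in> \<E> n" "measure M (sym_diff A E) < inverse (Suc n)"
        using \<E>(3)[OF A(1)] by blast
      have sets: "A \<in> sets M" "E \<in> sets M"
        using A E \<E> radon_prob_openin_sets[OF M] by auto
      have "measure M (sym_diff ?S E) \<le> measure M (sym_diff ?S A \<union> sym_diff A E)"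
        using S' sets by (intro finite_measure_mono) auto
      also have "\<dots> \<le> measure M (sym_diff ?S A) + measure M (sym_diff A E)"
        using S' sets by (intro measure_Un_le) auto
      also have "\<dots> < d" using A E n by simp
      finally have *: "measure M (sym_diff ?S E) < d" .
      have "emeasure (completion M) (sym_diff S E)
          \<le> emeasure (completion M) (sym_diff ?S E \<union> null_part M S)"
      proof (rule emeasure_mono)
        show "sym_diff S E \<subseteq> sym_diff ?S E \<union> null_part M S"
          using main_part_null_part_Un[OF S] by blast
        show "sym_diff ?S E \<union> null_part M S \<in> sets (completion M)"
          using S' sets null_part_null_sets[OF S] by (auto intro!: sets.Un sets.Diff)
      qed
      also have "\<dots> = emeasure (completion M) (sym_diff ?S E)"
        using S S' sets null_part_null_sets[OF S]
        by (intro emeasure_Un_null_set) auto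
      also have "\<dots> = emeasure M (sym_diff ?S E)"
        using S' sets by simp
      also have "\<dots> \<le> ennreal d"
        using * by (simp add: emeasure_eq_measure ennreal_leI)
      finally show ?thesis
        using E by (intro INF_lower2[of E]) auto
    qed
    have "(INF E\<in>(\<Union>n. \<E> n). emeasure (completion M) (sym_diff S E)) \<le> 0"
      by (rule ennreal_le_epsilon) (use le in simp)
    then show "(INF E\<in>(\<Union>n. \<E> n). emeasure (completion M) (sym_diff S E)) = 0" by simp
  qed
  moreover have "countable (\<Union>n. \<E> n)" using \<E> by auto
  ultimately show False using ns separable_measure_iff by blast
qed

subsection \<open>Radon extension of finitely additive measures on clopen sets\<close>

text \<open>A finitely additive probability on the algebra of clopen sets. Values on other sets are
  left arbitrary.\<close>

definition clopen_charge :: "'a topology \<Rightarrow> ('a set \<Rightarrow> real) \<Rightarrow> bool" where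
  "clopen_charge K m \<longleftrightarrow>
     (\<forall>A. clopenin K A \<longrightarrow> 0 \<le> m A) \<and>
     (\<forall>A B. clopenin K A \<and> clopenin K B \<and> A \<inter> B = {} \<longrightarrow> m (A \<union> B) = m A + m B) \<and>
     m (topspace K) = 1"

lemma clopen_charge_Diff:
  assumes "clopen_charge K m" "clopenin K A" "clopenin K B"
  shows "m A = m (A \<inter> B) + m (A - B)"
proof -
  have "clopenin K (A \<inter> B)" "clopenin K (A - B)" "(A \<inter> B) \<inter> (A - B) = {}"
    using assms by (blast intro: openin_diff closedin_diff)+
  then have "m ((A \<inter> B) \<union> (A - B)) = m (A \<inter> B) + m (A - B)"
    using assms(1) unfolding clopen_charge_def by blast
  then show ?thesis by (simp only: Int_Diff_Un)
qed

lemma clopen_charge_mono: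
  assumes "clopen_charge K m" "clopenin K A" "clopenin K B" "A \<subseteq> B"
  shows "m A \<le> m B"
proof -
  have "m B = m (B \<inter> A) + m (B - A)"
    using assms by (intro clopen_charge_Diff) auto
  moreover have "B \<inter> A = A" using assms by auto
  moreover have "clopenin K (B - A)"
    using assms by (blast intro: openin_diff closedin_diff)
  then have "0 \<le> m (B - A)"
    using assms(1) unfolding clopen_charge_def by blast
  ultimately show ?thesis by simp
qed

lemma clopen_charge_empty:
  assumes "clopen_charge K m"
  shows "m {} = 0"
proof -
  have "m {} = m ({} \<inter> {}) + m ({} - {})"
    by (rule clopen_charge_Diff[OF assms]) auto
  then show ?thesis unfolding Int_empty_left empty_Diff by linarith
qed

lemma clopen_charge_le_1: "clopen_charge K m \<Longrightarrow> clopenin K A \<Longrightarrow> m A \<le> 1"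
  using clopen_charge_mono[of K m A "topspace K"] openin_subset[of K A]
  by (metis clopen_charge_def closedin_topspace openin_topspace)

section \<open>Caratheodory's construction from clopen sets\<close>

definition inner_content :: "'a topology \<Rightarrow> ('a set \<Rightarrow> real) \<Rightarrow> 'a set \<Rightarrow> ennreal" where
  "inner_content K m U = (SUP A\<in>{A. clopenin K A \<and> A \<subseteq> U}. ennreal (m A))"

text \<open>The outer measure to which Caratheodory's theorem is applied: open sets are measured
  from inside by clopen sets, arbitrary sets from outside by open sets.\<close>

definition outer_content :: "'a topology \<Rightarrow> ('a set \<Rightarrow> real) \<Rightarrow> 'a set \<Rightarrow> ennreal" where
  "outer_content K m S = (INF U\<in>{U. openin K U \<and> S \<subseteq> U}. inner_content K m U)"

lemma inner_content_mono: "U \<subseteq> V \<Longrightarrow> inner_content K m U \<le> inner_content K m V"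
  unfolding inner_content_def by (rule SUP_subset_mono) auto

lemma inner_content_clopen:
  assumes "clopen_charge K m" "clopenin K A"
  shows "inner_content K m A = ennreal (m A)"
  unfolding inner_content_def
proof (rule antisym)
  show "(SUP B\<in>{B. clopenin K B \<and> B \<subseteq> A}. ennreal (m B)) \<le> ennreal (m A)"
    by (rule SUP_least) (use clopen_charge_mono[OF assms(1)] assms(2) in \<open>auto intro: ennreal_leI\<close>)
  show "ennreal (m A) \<le> (SUP B\<in>{B. clopenin K B \<and> B \<subseteq> A}. ennreal (m B))"
    by (rule SUP_upper) (use assms(2) in auto)
qed

text \<open>A clopen \<open>A\<close> inside the union splits into clopen pieces: the closed set
  \<open>A - V\<close> sits in a clopen \<open>B\<close> within \<open>U\<close>, so
  \<open>A \<inter> B\<close> is charged to \<open>U\<close> and \<open>A - B\<close> to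
  \<open>V\<close>.\<close>

lemma inner_content_Un_le:
  assumes K: "compact_space K" "K dim_le 0" and m: "clopen_charge K m"
    and U: "openin K U" and V: "openin K V"
  shows "inner_content K m (U \<union> V) \<le> inner_content K m U + inner_content K m V"
  unfolding inner_content_def[of K m "U \<union> V"]
proof (rule SUP_least, clarify)
  fix A assume A: "openin K A" "closedin K A" "A \<subseteq> U \<union> V"
  have "closedin K (A - V)" using A V by (simp add: closedin_diff)
  moreover have "A - V \<subseteq> U" using A by auto
  ultimately obtain B where B: "clopenin K B" "A - V \<subseteq> B" "B \<subseteq> U"
    using clopen_between[OF K _ U] by metis
  have c: "clopenin K (A \<inter> B)" "clopenin K (A - B)"
    using A B by (auto intro!: openin_diff closedin_diff)
  have "ennreal (m A) = ennreal (m (A \<inter> B)) + ennreal (m (A - B))"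
    using clopen_charge_Diff[OF m, of A B] A B m c by (simp add: clopen_charge_def)
  also have "\<dots> \<le> inner_content K m U + inner_content K m V"
    unfolding inner_content_def using A B c by (intro add_mono SUP_upper) auto
  finally show "ennreal (m A) \<le> inner_content K m U + inner_content K m V" .
qed

text \<open>Countably many open sets reduce to finitely many, because the content of the union is a
  supremum over clopen, hence compact, subsets.\<close>

lemma inner_content_UN_le:
  assumes K: "compact_space K" "K dim_le 0" and m: "clopen_charge K m"
    and U: "\<And>n::nat. openin K (U n)"
  shows "inner_content K m (\<Union>n. U n) \<le> (\<Sum>n. inner_content K m (U n))"
  unfolding inner_content_def[of K m "\<Union>n. U n"]
proof (rule SUP_least, clarify)
  fix A assume A: "openin K A" "closedin K A" "A \<subseteq> (\<Union>n. U n)"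
  have fin: "inner_content K m (\<Union>n<N. U n) \<le> (\<Sum>n<N. inner_content K m (U n))" for N
  proof (induction N)
    case 0
    show ?case using inner_content_clopen[OF m, of "{}"] clopen_charge_empty[OF m] by simp
  next
    case (Suc N)
    have "(\<Union>n<Suc N. U n) = (\<Union>n<N. U n) \<union> U N"
      by (auto simp: less_Suc_eq)
    then have "inner_content K m (\<Union>n<Suc N. U n)
        \<le> inner_content K m (\<Union>n<N. U n) + inner_content K m (U N)"
      using inner_content_Un_le[OF K m, of "\<Union>n<N. U n" "U N"] U by (simp only:) blast
    also have "\<dots> \<le> (\<Sum>n<N. inner_content K m (U n)) + inner_content K m (U N)"
      using Suc by (rule add_right_mono)
    finally show ?case by (simp only: sum.lessThan_Suc)
  qed
  have "compactin K A" using A K closedin_compact_space by blast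
  then obtain \<F> where \<F>: "finite \<F>" "\<F> \<subseteq> range U" "A \<subseteq> \<Union>\<F>"
    using compactinD[of K A "range U"] A(3) U by blast
  then obtain F where F: "finite F" "\<F> = U ` F"
    by (meson finite_subset_image)
  then obtain N where "F \<subseteq> {..<N}"
    using finite_nat_iff_bounded by auto
  with F \<F> have "A \<subseteq> (\<Union>n<N. U n)" by blast
  then have "ennreal (m A) \<le> inner_content K m (\<Union>n<N. U n)"
    unfolding inner_content_def using A by (intro SUP_upper) auto
  also note fin
  also have "(\<Sum>n<N. inner_content K m (U n)) \<le> (\<Sum>n. inner_content K m (U n))"
    by (rule sum_le_suminf) auto
  finally show "ennreal (m A) \<le> (\<Sum>n. inner_content K m (U n))" .
qed

lemma outer_content_mono: "S \<subseteq> T \<Longrightarrow> outer_content K m S \<le> outer_content K m T"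
  unfolding outer_content_def by (rule INF_superset_mono) auto

lemma outer_content_open: "openin K U \<Longrightarrow> outer_content K m U = inner_content K m U"
  unfolding outer_content_def
proof (rule antisym)
  assume "openin K U"
  then show "(INF V\<in>{V. openin K V \<and> U \<subseteq> V}. inner_content K m V) \<le> inner_content K m U"
    by (intro INF_lower) simp
  show "inner_content K m U \<le> (INF V\<in>{V. openin K V \<and> U \<subseteq> V}. inner_content K m V)"
    by (rule INF_greatest) (simp add: inner_content_mono)
qed

lemma outer_content_le_1:
  assumes "clopen_charge K m" "S \<subseteq> topspace K"
  shows "outer_content K m S \<le> 1"
proof -
  have "outer_content K m S \<le> outer_content K m (topspace K)"
    by (rule outer_content_mono) (use assms in auto)
  also have "\<dots> = 1"
    using assms inner_content_clopen[OF assms(1), of "topspace K"]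
    by (simp add: outer_content_open clopen_charge_def)
  finally show ?thesis .
qed

lemma outer_content_approx:
  assumes "clopen_charge K m" "S \<subseteq> topspace K" "0 < e"
  obtains U where "openin K U" "S \<subseteq> U" "inner_content K m U < outer_content K m S + ennreal e"
proof -
  have "outer_content K m S \<noteq> \<infinity>"
    using outer_content_le_1[OF assms(1,2)] ennreal_one_less_top
    by (metis leD infinity_ennreal_def)
  then obtain r where r: "0 \<le> r" "outer_content K m S = ennreal r"
    by (cases "outer_content K m S" rule: ennreal_cases) (auto simp: infinity_ennreal_def)
  have "ennreal r < ennreal (r + e)"
    using r(1) assms(3) by (subst ennreal_less_iff) auto
  also have "\<dots> = outer_content K m S + ennreal e"
    using r assms(3) by simp
  finally have "\<exists>U\<in>{U. openin K U \<and> S \<subseteq> U}. inner_content K m U < outer_content K m S + ennreal e"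
    unfolding r(2)[symmetric] by (subst (asm) (1) outer_content_def) (simp only: INF_less_iff)
  then show thesis
    using that by blast
qed

lemma outer_measure_space_outer_content:
  assumes K: "compact_space K" "K dim_le 0" and m: "clopen_charge K m"
  shows "outer_measure_space (Pow (topspace K)) (outer_content K m)"
  unfolding outer_measure_space_def
proof (intro conjI)
  show "positive (Pow (topspace K)) (outer_content K m)"
    using inner_content_clopen[OF m, of "{}"] clopen_charge_empty[OF m]
    by (simp add: positive_def outer_content_open)
  show "increasing (Pow (topspace K)) (outer_content K m)"
    by (simp add: increasing_def outer_content_mono)
  show "countably_subadditive (Pow (topspace K)) (outer_content K m)"
    unfolding countably_subadditive_def
  proof (intro allI impI)
    fix S :: "nat \<Rightarrow> 'a set"
    assume S: "range S \<subseteq> Pow (topspace K)"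
    show "outer_content K m (\<Union>i. S i) \<le> (\<Sum>i. outer_content K m (S i))"
    proof (rule ennreal_le_epsilon)
      fix e :: real assume e: "0 < e"
      \<comment> \<open>The error \<open>e\<close> is shared out geometrically, so that the open
        covers together lose at most \<open>e\<close>.\<close>
      have "\<exists>U. openin K U \<and> S n \<subseteq> U \<and>
          inner_content K m U < outer_content K m (S n) + ennreal (e * (1/2)^Suc n)" for n
      proof -
        have "S n \<subseteq> topspace K" "0 < e * (1/2)^Suc n" using S e by auto
        then show ?thesis by (metis outer_content_approx[OF m])
      qed
      then obtain U where U: "\<And>n. openin K (U n)" "\<And>n. S n \<subseteq> U n"
        "\<And>n. inner_content K m (U n) < outer_content K m (S n) + ennreal (e * (1/2)^Suc n)"
        by metis
      have "outer_content K m (\<Union>i. S i) \<le> outer_content K m (\<Union>i. U i)"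
        using U by (intro outer_content_mono) blast
      also have "\<dots> = inner_content K m (\<Union>i. U i)"
        using U by (intro outer_content_open) blast
      also have "\<dots> \<le> (\<Sum>i. inner_content K m (U i))"
        using inner_content_UN_le[OF K m] U by blast
      also have "\<dots> \<le> (\<Sum>i. outer_content K m (S i) + ennreal (e * (1/2)^Suc i))"
        using U by (intro suminf_le) (auto intro: less_imp_le)
      also have "\<dots> = (\<Sum>i. outer_content K m (S i)) + (\<Sum>i. ennreal (e * (1/2)^Suc i))"
        by (intro suminf_add[symmetric]) auto
      also have "(\<Sum>i. ennreal (e * (1/2)^Suc i)) = ennreal e"
      proof -
        have "(\<lambda>i. e * (1/2)^Suc i) sums e"
          using sums_mult[OF power_half_series, of e] by simp
        then show ?thesis
          using e by (intro suminf_ennreal_eq) auto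
      qed
      finally show "outer_content K m (\<Union>i. S i) \<le> (\<Sum>i. outer_content K m (S i)) + ennreal e" .
    qed
  qed
qed

text \<open>One inequality of the Caratheodory condition is subadditivity. For the other, let
  \<open>U\<close> be open and contain \<open>S\<close>: a clopen \<open>A\<close> in
  \<open>U \<inter> V\<close> and then a clopen \<open>B\<close> in \<open>U - A\<close> are
  disjoint, so \<open>m A + m B\<close> is at most the content of \<open>U\<close>. Since
  \<open>A\<close> is closed, \<open>U - A\<close> is an open set containing \<open>U - V\<close>;
  suprema over \<open>B\<close> and then over \<open>A\<close> finish the argument.\<close>

lemma openin_lambda_system_outer_content:
  assumes K: "compact_space K" "K dim_le 0" and m: "clopen_charge K m" and V: "openin K V"
  shows "V \<in> lambda_system (topspace K) (Pow (topspace K)) (outer_content K m)"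
proof -
  interpret algebra "topspace K" "Pow (topspace K)"
    by (rule algebra_Pow)
  have "outer_content K m (S \<inter> V) + outer_content K m (S - V) \<le> outer_content K m S"
    if S: "S \<subseteq> topspace K" for S
    unfolding outer_content_def[of K m S]
  proof (rule INF_greatest, clarify)
    fix U assume U: "openin K U" "S \<subseteq> U"
    have "outer_content K m (S \<inter> V) + outer_content K m (S - V)
        \<le> inner_content K m (U \<inter> V) + outer_content K m (U - V)"
      using U V by (intro add_mono, subst outer_content_open[symmetric])
        (auto intro!: outer_content_mono)
    also have "\<dots> = (SUP A\<in>{A. clopenin K A \<and> A \<subseteq> U \<inter> V}. ennreal (m A) + outer_content K m (U - V))"
      unfolding inner_content_def
      by (intro ennreal_SUP_add_left[symmetric]) auto
    also have "\<dots> \<le> inner_content K m U"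
    proof (rule SUP_least, clarify)
      fix A assume A: "openin K A" "closedin K A" "A \<subseteq> U \<inter> V"
      have "ennreal (m A) + outer_content K m (U - V) \<le> ennreal (m A) + outer_content K m (U - A)"
        using A by (intro add_mono outer_content_mono) auto
      also have "outer_content K m (U - A) = inner_content K m (U - A)"
        using A U by (intro outer_content_open) auto
      also have "ennreal (m A) + inner_content K m (U - A)
          = (SUP B\<in>{B. clopenin K B \<and> B \<subseteq> U - A}. ennreal (m A) + ennreal (m B))"
        unfolding inner_content_def
        by (rule ennreal_SUP_add_right) auto
      also have "\<dots> \<le> inner_content K m U"
      proof (rule SUP_least, clarify)
        fix B assume B: "openin K B" "closedin K B" "B \<subseteq> U - A"
        have "ennreal (m A) + ennreal (m B) = ennreal (m (A \<union> B))"
        proof -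
          have "A \<inter> B = {}" using B by auto
          then show ?thesis using m A B by (auto simp: clopen_charge_def)
        qed
        also have "\<dots> \<le> inner_content K m U"
          unfolding inner_content_def using A B by (intro SUP_upper) auto
        finally show "ennreal (m A) + ennreal (m B) \<le> inner_content K m U" .
      qed
      finally show "ennreal (m A) + outer_content K m (U - V) \<le> inner_content K m U" .
    qed
    finally show "outer_content K m (S \<inter> V) + outer_content K m (S - V) \<le> inner_content K m U" .
  qed
  moreover have "outer_content K m S \<le> outer_content K m (S \<inter> V) + outer_content K m (S - V)"
    if S: "S \<subseteq> topspace K" for S
  proof -
    have *: "positive (Pow (topspace K)) (outer_content K m)"
      "countably_subadditive (Pow (topspace K)) (outer_content K m)"
      using outer_measure_space_outer_content[OF K m] by (auto simp: outer_measure_space_def)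
    have "subadditive (Pow (topspace K)) (outer_content K m)"
      using ring_of_sets.countably_subadditive_subadditive[OF ring_of_sets_Pow *] .
    then have "outer_content K m ((S \<inter> V) \<union> (S - V))
        \<le> outer_content K m (S \<inter> V) + outer_content K m (S - V)"
      using S by (intro subadditiveD[of "Pow (topspace K)"]) auto
    moreover have "(S \<inter> V) \<union> (S - V) = S" by auto
    ultimately show ?thesis by simp
  qed
  ultimately show ?thesis
    unfolding lambda_system_eq using openin_subset[OF V] by (auto intro: antisym)
qed

text \<open>Caratheodory's theorem gives a Borel measure that is outer regular by construction;
  passing to complements turns approximation by open supersets into approximation by closed, hence
  compact, subsets.\<close>

lemma clopen_charge_radon_extension:
  assumes K: "compact_space K" "Hausdorff_space K" "K dim_le 0" and m: "clopen_charge K m"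
  obtains M where "radon_prob K M" "\<And>A. clopenin K A \<Longrightarrow> measure M A = m A"
proof -
  let ?\<Omega> = "topspace K" and ?O = "{U. openin K U}" and ?\<phi> = "outer_content K m"
  let ?L = "lambda_system ?\<Omega> (Pow ?\<Omega>) ?\<phi>"
  define M where "M = measure_of ?\<Omega> ?O ?\<phi>"
  have O: "?O \<subseteq> Pow ?\<Omega>" using openin_subset by auto
  have ms: "measure_space ?\<Omega> ?L ?\<phi>"
    using sigma_algebra.caratheodory_lemma[OF sigma_algebra_Pow
        outer_measure_space_outer_content[OF K(1,3) m]] .
  have "sigma_sets ?\<Omega> ?O \<subseteq> ?L"
    using ms openin_lambda_system_outer_content[OF K(1,3) m]
    by (intro sigma_algebra.sigma_sets_subset) (auto simp: measure_space_def)
  then have "measure_space ?\<Omega> (sigma_sets ?\<Omega> ?O) ?\<phi>"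
    using measure_down[OF ms sigma_algebra_sigma_sets[OF O]] by blast
  then have em: "emeasure M S = ?\<phi> S" if "S \<in> sets M" for S
    by (intro emeasure_measure_of[OF M_def O]) (use that O in \<open>simp_all add: M_def measure_space_def\<close>)
  have sp: "space M = ?\<Omega>" and sets: "sets M = sigma_sets ?\<Omega> ?O"
    using O by (simp_all add: M_def)
  have op: "U \<in> sets M" if "openin K U" for U
    using that by (simp add: sets sigma_sets.Basic)
  have clo: "emeasure M A = ennreal (m A)" if "clopenin K A" for A
    using that em op inner_content_clopen[OF m] by (simp add: outer_content_open)
  interpret prob_space M
  proof
    show "emeasure M (space M) = 1"
      using clo[of ?\<Omega>] m by (simp add: sp clopen_charge_def)
  qed
  have "emeasure M S = (SUP C\<in>{C. compactin K C \<and> C \<subseteq> S}. emeasure M C)" if S: "S \<in> sets M" for S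
  proof (rule antisym)
    show "(SUP C\<in>{C. compactin K C \<and> C \<subseteq> S}. emeasure M C) \<le> emeasure M S"
      using S by (auto intro!: SUP_least emeasure_mono)
    show "emeasure M S \<le> (SUP C\<in>{C. compactin K C \<and> C \<subseteq> S}. emeasure M C)"
    proof (rule ennreal_le_epsilon)
      fix e :: real assume e: "0 < e"
      obtain U where U: "openin K U" "?\<Omega> - S \<subseteq> U" "inner_content K m U < ?\<phi> (?\<Omega> - S) + ennreal e"
        using outer_content_approx[OF m, of "?\<Omega> - S" e] e by auto
      have S': "?\<Omega> - S \<in> sets M" using S by (simp flip: sp)
      have "emeasure M U < emeasure M (?\<Omega> - S) + ennreal e"
        using U em[OF op[OF U(1)]] em[OF S'] by (simp add: outer_content_open)
      then have "measure M U < measure M (?\<Omega> - S) + e"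
        using e by (simp add: emeasure_eq_measure ennreal_less_iff flip: ennreal_plus)
      moreover have "measure M (?\<Omega> - S) = 1 - measure M S" "measure M (?\<Omega> - U) = 1 - measure M U"
        using prob_compl S op[OF U(1)] sp by auto
      ultimately have "measure M S \<le> measure M (?\<Omega> - U) + e" by simp
      then have "emeasure M S \<le> emeasure M (?\<Omega> - U) + ennreal e"
        using e by (simp add: emeasure_eq_measure ennreal_leI flip: ennreal_plus)
      also have "compactin K (?\<Omega> - U)"
        using U K closedin_compact_space by blast
      then have "emeasure M (?\<Omega> - U) \<le> (SUP C\<in>{C. compactin K C \<and> C \<subseteq> S}. emeasure M C)"
        using U by (intro SUP_upper) auto
      finally show "emeasure M S \<le> (SUP C\<in>{C. compactin K C \<and> C \<subseteq> S}. emeasure M C) + ennreal e"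
        by (simp add: add_right_mono)
    qed
  qed
  then have "radon_prob K M"
    unfolding radon_prob_def using sp sets prob_space_axioms by blast
  moreover have "measure M A = m A" if "clopenin K A" for A
    using clo[OF that] m that by (simp add: measure_def clopen_charge_def)
  ultimately show thesis using that by blast
qed

section \<open>Cluster points of sequences of charges\<close>

text \<open>The product of copies of the unit interval, one for each set, is compact, and the
  conditions on a charge are equations and inequalities between coordinates, so they survive in the
  limit. Eventual lower bounds survive too; they are all that concentration and separation require
  later.\<close>

lemma clopen_charge_cluster_point:
  assumes m: "\<And>n::nat. clopen_charge K (m n)"
  obtains l where "clopen_charge K l"
    "\<And>A c. clopenin K A \<Longrightarrow> (\<forall>\<^sub>F n in sequentially. c \<le> m n A) \<Longrightarrow> c \<le> l A"
proof -
  \<comment> \<open>The charges are reset to 0 off the clopen sets, since their values there need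
    not lie in the unit interval.\<close>
  define m' where "m' n A = (if clopenin K A then m n A else 0)" for n A
  let ?P = "PiE UNIV (\<lambda>_::'a set. {0..1::real})"
  have "compactin (product_topology (\<lambda>_::'a set. euclideanreal) UNIV) ?P"
    by (subst compactin_PiE) auto
  then have "compact ?P"
    by (simp add: euclidean_product_topology)
  moreover have "\<forall>\<^sub>F g in filtermap m' sequentially. g \<in> ?P"
    unfolding eventually_filtermap
    by (rule always_eventually) (use m clopen_charge_le_1[OF m] in \<open>auto simp: m'_def clopen_charge_def\<close>)
  moreover have "filtermap m' sequentially \<noteq> bot"
    by (simp add: filtermap_bot_iff)
  ultimately obtain l where l: "inf (nhds l) (filtermap m' sequentially) \<noteq> bot"
    unfolding compact_filter by blast
  \<comment> \<open>\<open>G\<close> refines both the neighbourhood filter of \<open>l\<close> and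
    the sequence, so limits can be taken along it even when no subsequence converges.\<close>
  define G where "G = inf (nhds l) (filtermap m' sequentially)"
  have G: "G \<noteq> bot" using l by (simp add: G_def)
  have lim: "((\<lambda>g. g A) \<longlongrightarrow> l A) G" for A
  proof -
    have "((\<lambda>g. g A) \<longlongrightarrow> l A) (nhds l)"
    proof (rule topological_tendstoI)
      fix S :: "real set" assume S: "open S" "l A \<in> S"
      have "continuous_on UNIV (\<lambda>g::'a set \<Rightarrow> real. g A)"
        by (rule continuous_on_product_coordinates)
      then have "open ((\<lambda>g::'a set \<Rightarrow> real. g A) -` S)"
        using S(1) by (simp add: open_vimage)
      then show "\<forall>\<^sub>F g in nhds l. g A \<in> S"
        unfolding eventually_nhds using S(2) by (intro exI[of _ "(\<lambda>g::'a set \<Rightarrow> real. g A) -` S"]) auto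
    qed
    then show ?thesis
      unfolding G_def by (rule tendsto_mono[rotated]) simp
  qed
  have ev: "\<forall>\<^sub>F g in G. Q g" if "\<forall>\<^sub>F n in sequentially. Q (m' n)" for Q
    using that unfolding G_def
    by (metis eventually_filtermap filter_leD inf_le2)
  show thesis
  proof
    show "clopen_charge K l"
      unfolding clopen_charge_def
    proof (intro conjI allI impI)
      fix A assume "clopenin K A"
      then show "0 \<le> l A"
        using m by (intro tendsto_lowerbound[OF lim _ G] ev) (simp add: m'_def clopen_charge_def)
    next
      fix A B assume AB: "clopenin K A \<and> clopenin K B \<and> A \<inter> B = {}"
      have "\<forall>\<^sub>F g in G. g (A \<union> B) = g A + g B"
        using AB m by (intro ev) (auto simp: m'_def clopen_charge_def)
      then have "((\<lambda>g. g A + g B) \<longlongrightarrow> l (A \<union> B)) G"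
        using lim[of "A \<union> B"] by (simp add: tendsto_cong)
      moreover have "((\<lambda>g. g A + g B) \<longlongrightarrow> l A + l B) G"
        by (intro tendsto_add lim)
      ultimately show "l (A \<union> B) = l A + l B"
        using tendsto_unique[OF G] by blast
    next
      have "m' n (topspace K) = 1" for n
        using m[of n] by (simp add: m'_def clopen_charge_def)
      then have "\<forall>\<^sub>F g in G. g (topspace K) = 1"
        by (intro ev) simp
      then have "((\<lambda>g. 1) \<longlongrightarrow> l (topspace K)) G"
        using lim[of "topspace K"] tendsto_cong by force
      then show "l (topspace K) = 1"
        using tendsto_unique[OF G _ tendsto_const] by blast
    qed
  next
    fix A c assume A: "clopenin K A" and c: "\<forall>\<^sub>F n in sequentially. c \<le> m n A"
    then have "\<forall>\<^sub>F g in G. c \<le> g A"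
      by (intro ev) (simp add: m'_def)
    then show "c \<le> l A"
      by (intro tendsto_lowerbound[OF lim _ G])
  qed
qed

subsection \<open>Precalibers and families of closed sets\<close>

text \<open>The precaliber property speaks of a set of classes, whereas the sets \<open>B i\<close>
  are indexed and many of them may agree modulo null sets. Either one class is taken uncountably
  often, and then it is centered by itself, or the property applies to uncountably many distinct
  classes.\<close>

lemma omega1_precaliber_family:
  assumes L: "omega1_precaliber (measure_algebra N)" and I: "uncountable I"
    and B: "\<And>i. i \<in> I \<Longrightarrow> B i \<in> sets N" "\<And>i. i \<in> I \<Longrightarrow> B i \<notin> null_sets N"
  obtains J where "J \<subseteq> I" "uncountable J"
    "\<And>F. F \<subseteq> J \<Longrightarrow> finite F \<Longrightarrow> F \<noteq> {} \<Longrightarrow> (\<Inter>i\<in>F. B i) \<notin> null_sets N"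
proof -
  define c where "c i = null_class N (B i)" for i
  have "\<exists>G. G \<subseteq> c ` I \<and> centered (measure_algebra N) G \<and> uncountable {i\<in>I. c i \<in> G}"
  proof (cases "countable (c ` I)")
    case True
    have "\<exists>i0\<in>I. uncountable {i\<in>I. c i \<in> {c i0}}"
    proof (rule ccontr)
      assume "\<not> ?thesis"
      then have "countable (\<Union>a\<in>c ` I. {i\<in>I. c i \<in> {a}})"
        using True by (intro countable_UN) auto
      moreover have "(\<Union>a\<in>c ` I. {i\<in>I. c i \<in> {a}}) = I" by auto
      ultimately show False using I by simp
    qed
    then obtain i0 where i0: "i0 \<in> I" "uncountable {i\<in>I. c i \<in> {c i0}}" by blast
    have "centered (measure_algebra N) (null_class N ` {B i0})"
      using B i0 by (subst centered_measure_algebra_iff) (auto simp: subset_singleton_iff)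
    then show ?thesis
      using i0 by (intro exI[of _ "{c i0}"]) (auto simp: c_def)
  next
    case False
    have "c ` I \<subseteq> carrier (measure_algebra N) - {\<bottom>\<^bsub>measure_algebra N\<^esub>}"
    proof
      fix a assume "a \<in> c ` I"
      then obtain i where i: "i \<in> I" "a = null_class N (B i)" by (auto simp: c_def)
      then have "a \<noteq> null_class N {}"
        using B null_class_eq_iff[of "B i" N "{}"] by simp
      then show "a \<in> carrier (measure_algebra N) - {\<bottom>\<^bsub>measure_algebra N\<^esub>}"
        using i B by (simp add: carrier_measure_algebra bottom_measure_algebra)
    qed
    then obtain G where G: "G \<subseteq> c ` I" "uncountable G" "centered (measure_algebra N) G"
      using L False unfolding omega1_precaliber_def by meson
    have "G \<subseteq> c ` {i\<in>I. c i \<in> G}" using G by blast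
    then have "uncountable {i\<in>I. c i \<in> G}"
      using G(2) countable_image countable_subset by metis
    then show ?thesis using G by blast
  qed
  then obtain G where G: "G \<subseteq> c ` I" "centered (measure_algebra N) G" "uncountable {i\<in>I. c i \<in> G}"
    by blast
  let ?J = "{i\<in>I. c i \<in> G}"
  have "null_class N ` B ` ?J = G"
    using G(1) unfolding c_def by blast
  then have cent: "\<forall>\<A>. \<A> \<subseteq> B ` ?J \<and> finite \<A> \<and> \<A> \<noteq> {} \<longrightarrow> \<Inter>\<A> \<notin> null_sets N"
    using G(2) B centered_measure_algebra_iff[of "B ` ?J" N] by (auto simp: image_subset_iff)
  show thesis
  proof (rule that[of ?J])
    fix F assume "F \<subseteq> ?J" "finite F" "F \<noteq> {}"
    then have "B ` F \<subseteq> B ` ?J \<and> finite (B ` F) \<and> B ` F \<noteq> {}" by blast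
    with cent show "(\<Inter>i\<in>F. B i) \<notin> null_sets N" by blast
  qed (use G in auto)
qed

text \<open>Moves a measure to a homeomorphic space over another type of points; the precaliber
  hypothesis is stated for spaces over one fixed type.\<close>

lemma radon_prob_homeomorphic_image:
  fixes j :: "'a \<Rightarrow> 'b"
  assumes K: "Hausdorff_space K" and M: "radon_prob K M" and j: "homeomorphic_map K X j"
  obtains N where "radon_prob X N" "\<And>S. S \<in> sets M \<Longrightarrow> j ` S \<in> sets N"
    "\<And>S. S \<in> sets M \<Longrightarrow> emeasure N (j ` S) = emeasure M S"
proof -
  let ?\<Omega> = "topspace X" and ?O = "{W. openin X W}"
  interpret prob_space M using M by (simp add: radon_prob_def)
  have sp: "space M = topspace K" and sM: "sets M = sigma_sets (topspace K) {U. openin K U}"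
    using M by (auto simp: radon_prob_def)
  have inj: "inj_on j (topspace K)" and img: "j ` topspace K = ?\<Omega>"
    and oimg: "\<And>U. U \<subseteq> topspace K \<Longrightarrow> openin X (j ` U) \<longleftrightarrow> openin K U"
    using j by (auto simp: homeomorphic_eq_everything_map homeomorphic_map_openness_eq
        dest: homeomorphic_map_openness[OF j])
  have cj: "continuous_map K X j" using j homeomorphic_imp_continuous_map by blast
  define N where "N = distr M (measure_of ?\<Omega> ?O (\<lambda>_. 0)) j"
  have O: "?O \<subseteq> Pow ?\<Omega>" using openin_subset by auto
  have spN: "space N = ?\<Omega>" and sN: "sets N = sigma_sets ?\<Omega> ?O"
    using O by (simp_all add: N_def)
  have meas: "j \<in> measurable M (measure_of ?\<Omega> ?O (\<lambda>_. 0))"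
  proof (rule measurable_measure_of[OF O])
    show "j \<in> space M \<rightarrow> ?\<Omega>" using img sp by auto
    fix W assume "W \<in> ?O"
    then have "openin K {x \<in> topspace K. j x \<in> W}"
      using cj by (simp add: continuous_map_def)
    moreover have "{x \<in> topspace K. j x \<in> W} = j -` W \<inter> space M" using sp by auto
    ultimately show "j -` W \<inter> space M \<in> sets M"
      using radon_prob_openin_sets[OF M] by simp
  qed
  have emN: "emeasure N W = emeasure M (j -` W \<inter> space M)" if "W \<in> sets N" for W
    using that meas unfolding N_def by (subst emeasure_distr) auto
  have vim: "j -` (j ` S) \<inter> space M = S" if "S \<subseteq> topspace K" for S
    using that inj sp by (auto simp: inj_on_def)
  have imgs: "j ` S \<in> sets N" if "S \<in> sets M" for S
  proof -
    have "S \<in> sigma_sets (topspace K) {U. openin K U}" using that sM by simp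
    then show ?thesis
    proof induction
      case (Basic U)
      then show ?case using oimg[of U] openin_subset[of K U] sN by auto
    next
      case Empty
      then show ?case by simp
    next
      case (Compl U)
      have "U \<subseteq> topspace K"
        using Compl.hyps sM sets.sets_into_space[of U M] sp by simp
      then have "j ` (topspace K - U) = space N - j ` U"
        using inj_on_image_set_diff[OF inj, of "topspace K" U] img spN by auto
      then show ?case using Compl.IH by auto
    next
      case (Union U)
      then show ?case by (auto simp: image_UN)
    qed
  qed
  have "emeasure N W = (SUP C\<in>{C. compactin X C \<and> C \<subseteq> W}. emeasure N C)" if W: "W \<in> sets N" for W
  proof (rule antisym)
    show "(SUP C\<in>{C. compactin X C \<and> C \<subseteq> W}. emeasure N C) \<le> emeasure N W"
      using W by (intro SUP_least emeasure_mono) auto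
    have "j -` W \<inter> space M \<in> sets M"
      using W meas by (intro measurable_sets[OF meas]) (simp add: N_def)
    then have "emeasure N W = (SUP C\<in>{C. compactin K C \<and> C \<subseteq> j -` W \<inter> space M}. emeasure M C)"
      using M emN[OF W] by (simp add: radon_prob_def)
    also have "\<dots> \<le> (SUP C\<in>{C. compactin X C \<and> C \<subseteq> W}. emeasure N C)"
    proof (rule SUP_mono, clarify)
      fix C assume C: "compactin K C" "C \<subseteq> j -` W \<inter> space M"
      have "C \<in> sets M"
        using C K radon_prob_closedin_sets[OF M] compactin_imp_closedin by blast
      then have "emeasure M C = emeasure N (j ` C)"
        using emN[OF imgs] vim[of C] C sp by simp
      moreover have "compactin X (j ` C)"
        using C cj image_compactin by blast
      moreover have "j ` C \<subseteq> W" using C by auto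
      ultimately show "\<exists>D\<in>{C. compactin X C \<and> C \<subseteq> W}. emeasure M C \<le> emeasure N D"
        by auto
    qed
    finally show "emeasure N W \<le> (SUP C\<in>{C. compactin X C \<and> C \<subseteq> W}. emeasure N C)" .
  qed
  moreover have "prob_space N"
    unfolding N_def by (rule prob_space_distr[OF meas])
  ultimately have "radon_prob X N"
    unfolding radon_prob_def using spN sN by blast
  moreover have "emeasure N (j ` S) = emeasure M S" if "S \<in> sets M" for S
    using emN[OF imgs[OF that]] vim[of S] sets.sets_into_space[OF that] sp by simp
  ultimately show thesis using that imgs by blast
qed

text \<open>Finite intersections of a centered subfamily are not null, hence nonempty, so
  compactness supplies a common point of a whole uncountable subfamily.\<close>

lemma omega1_precaliber_closed_family:
  fixes j :: "'a \<Rightarrow> 'b"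
  fixes K :: "'a topology"
  assumes pc: "omega1_precaliber_measure_algebras TYPE('b)" and j: "inj j"
    and K: "compact_space K" "Hausdorff_space K" and M: "radon_prob K M"
    and I: "uncountable I"
    and B: "\<And>i. i \<in> I \<Longrightarrow> closedin K (B i)" "\<And>i. i \<in> I \<Longrightarrow> measure M (B i) \<noteq> 0"
  obtains J x where "J \<subseteq> I" "uncountable J" "x \<in> topspace K" "\<And>i. i \<in> J \<Longrightarrow> x \<in> B i"
proof -
  \<comment> \<open>A copy of \<open>K\<close> on the points \<open>j x\<close>: its open sets are
    exactly the images of those of \<open>K\<close>.\<close>
  define X where "X = pullback_topology (j ` topspace K) (inv j) K"
  have img: "j ` topspace K = topspace X"
    using j by (auto simp: X_def topspace_pullback_topology)
  have openX: "openin X W \<longleftrightarrow> (\<exists>U. openin K U \<and> W = j ` U)" for W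
  proof -
    have "inv j -` U \<inter> j ` topspace K = j ` U" if "openin K U" for U
      using j openin_subset[OF that] by auto
    then show ?thesis unfolding X_def openin_pullback_topology by metis
  qed
  have hom: "homeomorphic_map K X j"
  proof (rule bijective_open_imp_homeomorphic_map)
    show "open_map K X j" using openX by (auto simp: open_map_def)
    show "continuous_map K X j"
      unfolding continuous_map_def
    proof (intro conjI allI impI)
      show "j \<in> topspace K \<rightarrow> topspace X" using img by auto
      fix W assume "openin X W"
      then obtain U where U: "openin K U" "W = j ` U" using openX by auto
      then have "{x \<in> topspace K. j x \<in> W} = U"
        using j openin_subset[of K U] by (auto simp: inj_def)
      then show "openin K {x \<in> topspace K. j x \<in> W}" using U by simp
    qed
    show "inj_on j (topspace K)" using j by (meson inj_on_subset subset_UNIV)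
  qed (use img in auto)
  then have X: "compact_space X" "Hausdorff_space X"
    using K homeomorphic_map_imp_homeomorphic_space homeomorphic_compact_space
      homeomorphic_Hausdorff_space by blast+
  obtain N where N: "radon_prob X N" "\<And>S. S \<in> sets M \<Longrightarrow> j ` S \<in> sets N"
    "\<And>S. S \<in> sets M \<Longrightarrow> emeasure N (j ` S) = emeasure M S"
    using radon_prob_homeomorphic_image[OF K(2) M hom] by metis
  have "omega1_precaliber (measure_algebra N)"
    using pc X N(1) unfolding omega1_precaliber_measure_algebras_def by blast
  moreover have "j ` B i \<in> sets N" "j ` B i \<notin> null_sets N" if "i \<in> I" for i
    using N(2,3)[OF radon_prob_closedin_sets[OF M B(1)[OF that]]] B(2)[OF that]
    by (auto simp: null_sets_def measure_def)
  ultimately obtain J where J: "J \<subseteq> I" "uncountable J"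
    "\<And>F. F \<subseteq> J \<Longrightarrow> finite F \<Longrightarrow> F \<noteq> {} \<Longrightarrow> (\<Inter>i\<in>F. j ` B i) \<notin> null_sets N"
    using omega1_precaliber_family[OF _ I, of N "\<lambda>i. j ` B i"] by metis
  have "\<Inter>\<F> \<noteq> {}" if "finite \<F>" "\<F> \<subseteq> B ` J" for \<F>
  proof -
    obtain F where F: "F \<subseteq> J" "finite F" "\<F> = B ` F"
      using \<open>finite \<F>\<close> \<open>\<F> \<subseteq> B ` J\<close> by (meson finite_subset_image)
    show ?thesis
    proof (cases "F = {}")
      case False
      have "(\<Inter>i\<in>F. j ` B i) \<noteq> {}"
        using J(3)[OF F(1,2) False] by (metis null_sets.empty_sets)
      moreover have "(\<Inter>i\<in>F. j ` B i) = j ` (\<Inter>i\<in>F. B i)"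
      proof -
        obtain i where "i \<in> F" using False by blast
        then show ?thesis using j by (intro image_INT[symmetric, of j UNIV]) auto
      qed
      ultimately show ?thesis using F by auto
    qed (use F in auto)
  qed
  moreover have "\<forall>C\<in>B ` J. closedin K C"
    using B(1) J(1) by blast
  ultimately have "\<Inter>(B ` J) \<noteq> {}"
    using compact_space_fip[THEN iffD1, OF K(1), rule_format, of "B ` J"] by simp
  then obtain x where x: "\<And>i. i \<in> J \<Longrightarrow> x \<in> B i" by blast
  moreover obtain i where "i \<in> J" using J(2) by (metis countable_empty equals0I)
  ultimately have "x \<in> topspace K"
    using B(1) J(1) closedin_subset by blast
  then show thesis using that J x by blast
qed

subsection \<open>Clopen sets far from their predecessors\<close>

text \<open>The index set is a copy of the first uncountable cardinal, obtained as the cardinal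
  successor of \<open>natLeq\<close>, which lives on sets of naturals. Proper initial segments of a
  cardinal are smaller than it, hence countable here; \<open>R\<close> is the strict part of the
  order.\<close>

lemma uncountable_wf_countable_segments:
  obtains I :: "nat set set" and R :: "nat set rel"
  where "uncountable I" "wf R" "\<And>i. i \<in> I \<Longrightarrow> countable {j. (j, i) \<in> R}"
    "\<And>i j. i \<in> I \<Longrightarrow> j \<in> I \<Longrightarrow> i \<noteq> j \<Longrightarrow> (i, j) \<in> R \<or> (j, i) \<in> R"
    "R \<subseteq> I \<times> I"
proof -
  include cardinal_syntax
  let ?r = "cardSuc natLeq"
  have c: "countable A \<longleftrightarrow> |A| \<le>o natLeq" for A :: "nat set set"
    by (metis countable_card_of_nat card_of_nat ordLeq_ordIso_trans ordIso_symmetric)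
  have r: "Card_order ?r"
    by (rule cardSuc_Card_order[OF natLeq_Card_order])
  then have wo: "Well_order ?r" by (simp add: card_order_on_def)
  show thesis
  proof (rule that[of "Field ?r" "?r - Id"])
    show "uncountable (Field ?r)"
    proof
      assume "countable (Field ?r)"
      then have "?r \<le>o natLeq"
        using c card_of_Field_ordIso[OF r] ordIso_ordLeq_trans ordIso_symmetric by blast
      then show False
        using cardSuc_greater[OF natLeq_Card_order] not_ordLess_ordLeq by blast
    qed
    show "wf (?r - Id)" using wo by (simp add: well_order_on_def)
    fix i assume i: "i \<in> Field ?r"
    have "{j. (j, i) \<in> ?r - Id} = underS ?r i" by (auto simp: underS_def)
    moreover have "|underS ?r i| \<le>o natLeq"
      using card_of_underS[OF r i] cardSuc_ordLeq_ordLess[OF natLeq_Card_order card_of_Card_order] by blast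
    ultimately show "countable {j. (j, i) \<in> ?r - Id}" using c by simp
  next
    fix i j assume "i \<in> Field ?r" "j \<in> Field ?r" "i \<noteq> j"
    moreover have "total_on (Field ?r) ?r"
      using wo by (simp add: well_order_on_def linear_order_on_def)
    ultimately show "(i, j) \<in> ?r - Id \<or> (j, i) \<in> ?r - Id"
      by (auto simp: total_on_def)
  next
    show "?r - Id \<subseteq> Field ?r \<times> Field ?r" by (auto simp: Field_def)
  qed
qed

text \<open>Well-founded recursion along \<open>R\<close>: an index has countably many predecessors
  and \<open>\<V>\<close> is countable, so only countably many finite unions have to be avoided at
  each stage.\<close>

lemma far_clopen_family:
  fixes M :: "'a measure"
  assumes M: "radon_prob K M" and \<V>: "countable \<V>" "\<V> \<subseteq> sets M"
    and e: "\<And>\<E>. countable \<E> \<Longrightarrow> \<E> \<subseteq> sets M \<Longrightarrow>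
      \<exists>A. clopenin K A \<and> (\<forall>E\<in>\<E>. e \<le> measure M (sym_diff A E))"
    and R: "wf R" "\<And>i. i \<in> I \<Longrightarrow> countable {j. (j, i) \<in> R}" "R \<subseteq> I \<times> I"
  obtains A where "\<And>i. i \<in> I \<Longrightarrow> clopenin K (A i)"
    "\<And>i F. i \<in> I \<Longrightarrow> finite F \<Longrightarrow> F \<subseteq> \<V> \<times> {j. (j, i) \<in> R} \<Longrightarrow>
      e \<le> measure M (sym_diff (A i) (\<Union>(V, j)\<in>F. V \<inter> A j))"
proof -
  \<comment> \<open>Filtering by clopenness keeps every member of \<open>gen \<A>\<close> measurable
    for arbitrary \<open>\<A>\<close>, so the choice succeeds before the earlier values are known to
    be clopen.\<close>
  define gen :: "'a set set \<Rightarrow> 'a set set"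
    where "gen \<A> = (\<lambda>F. \<Union>(V, B)\<in>F. V \<inter> B) ` {F. finite F \<and> F \<subseteq> \<V> \<times> (\<A> \<inter> {B. clopenin K B})}" for \<A>
  define P where "P \<A> A \<longleftrightarrow> clopenin K A \<and> (\<forall>E\<in>gen \<A>. e \<le> measure M (sym_diff A E))" for \<A> A
  define A where "A = wfrec R (\<lambda>A i. SOME a. P (A ` {j. (j, i) \<in> R}) a)"
  have A: "A i = (SOME a. P (A ` {j. (j, i) \<in> R}) a)" for i
  proof -
    have "cut A R i ` {j. (j, i) \<in> R} = A ` {j. (j, i) \<in> R}"
      by (auto simp: cut_apply intro!: image_cong)
    then show ?thesis
      unfolding A_def by (subst wfrec[OF R(1)]) simp
  qed
  have ex: "\<exists>a. P \<A> a" if "countable \<A>" for \<A>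
  proof -
    have "countable (gen \<A>)"
      unfolding gen_def using \<V> that
      by (intro countable_image countable_Collect_finite_subset countable_SIGMA) auto
    moreover have "gen \<A> \<subseteq> sets M"
    proof
      fix E assume "E \<in> gen \<A>"
      then obtain F where F: "finite F" "F \<subseteq> \<V> \<times> (\<A> \<inter> {B. clopenin K B})" "E = (\<Union>(V, B)\<in>F. V \<inter> B)"
        by (auto simp: gen_def)
      have "(case p of (V, B) \<Rightarrow> V \<inter> B) \<in> sets M" if "p \<in> F" for p
        using F(2) that \<V>(2) radon_prob_openin_sets[OF M] by (auto intro!: sets.Int)
      then show "E \<in> sets M"
        unfolding F(3) using F(1) by (intro sets.finite_UN) auto
    qed
    ultimately show ?thesis using e unfolding P_def by blast
  qed
  have P: "P (A ` {j. (j, i) \<in> R}) (A i)" if "i \<in> I" for i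
    using someI_ex[OF ex[OF countable_image[OF R(2)[OF that], of A]]] A[of i] by simp
  show thesis
  proof
    show clo: "clopenin K (A i)" if "i \<in> I" for i
      using P[OF that] by (simp add: P_def)
    fix i F assume i: "i \<in> I" and F: "finite F" "F \<subseteq> \<V> \<times> {j. (j, i) \<in> R}"
    let ?F = "(\<lambda>(V, j). (V, A j)) ` F"
    have "?F \<subseteq> \<V> \<times> (A ` {j. (j, i) \<in> R} \<inter> {B. clopenin K B})"
      using F(2) clo R(3) by auto
    then have "(\<Union>(V, B)\<in>?F. V \<inter> B) \<in> gen (A ` {j. (j, i) \<in> R})"
      unfolding gen_def using F(1) by blast
    moreover have "(\<Union>(V, B)\<in>?F. V \<inter> B) = (\<Union>(V, j)\<in>F. V \<inter> A j)" by auto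
    ultimately show "e \<le> measure M (sym_diff (A i) (\<Union>(V, j)\<in>F. V \<inter> A j))"
      using P[OF i] unfolding P_def by metis
  qed
qed

section \<open>Cylinders pulled back from the Cantor space, and approximation on them\<close>

definition cylinder :: "'a topology \<Rightarrow> ('a \<Rightarrow> nat \<Rightarrow> bool) \<Rightarrow> bool list \<Rightarrow> 'a set" where
  "cylinder K f l = {y \<in> topspace K. \<forall>k<length l. f y k = l ! k}"

lemma clopenin_cylinder:
  assumes "continuous_map K cantor_space f"
  shows "clopenin K (cylinder K f l)"
proof -
  have cont: "continuous_map K (discrete_topology UNIV) (\<lambda>y. f y k)" for k
    using assms by (simp add: continuous_map_componentwise_UNIV)
  have c: "clopenin K {y \<in> topspace K. f y k \<in> {b}}" for k b
    using openin_continuous_map_preimage[OF cont, of "{b}" k]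
      closedin_continuous_map_preimage[OF cont, of "{b}" k] by simp
  have "clopenin K {y \<in> topspace K. \<forall>k<n. f y k = l ! k}" for n
  proof (induction n)
    case (Suc n)
    have "{y \<in> topspace K. \<forall>k<Suc n. f y k = l ! k} =
      {y \<in> topspace K. \<forall>k<n. f y k = l ! k} \<inter> {y \<in> topspace K. f y n \<in> {l ! n}}"
      by (auto simp: less_Suc_eq)
    then show ?case using Suc c[of n "l ! n"] by (simp only:) blast
  qed simp
  then show ?thesis by (simp add: cylinder_def)
qed

lemma mem_cylinder_iff:
  "y \<in> cylinder K f l \<longleftrightarrow> y \<in> topspace K \<and> l = map (f y) [0..<length l]"
  unfolding cylinder_def list_eq_iff_nth_eq[of l "map (f y) [0..<length l]"] by auto

text \<open>Call a cylinder bad if on it some \<open>A j\<close> differs from \<open>A0\<close> by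
  at most the proportion \<open>d\<close>. Splicing the sets \<open>A j\<close> over disjoint bad
  cylinders yields a set that differs from \<open>A0\<close> by at most \<open>d\<close> on the part
  covered. As it is still \<open>e\<close>-far from \<open>A0\<close>, the part left uncovered has
  measure at least \<open>e - d\<close>.\<close>

lemma measure_outside_approximating_cylinders:
  assumes M: "radon_prob K M" and f: "continuous_map K cantor_space f"
    and A0: "clopenin K A0" and A: "\<And>j. j \<in> J \<Longrightarrow> clopenin K (A j)" and d: "0 \<le> d"
    and far: "\<And>F. finite F \<Longrightarrow> F \<subseteq> range (cylinder K f) \<times> J \<Longrightarrow>
      e \<le> measure M (sym_diff A0 (\<Union>(V, j)\<in>F. V \<inter> A j))"
  shows "e \<le> d + measure M (topspace K - \<Union>{cylinder K f l | l. \<exists>j\<in>J.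
      measure M (sym_diff A0 (A j) \<inter> cylinder K f l) \<le> d * measure M (cylinder K f l)})"
proof -
  interpret prob_space M using M by (simp add: radon_prob_def)
  have sp: "space M = topspace K" using M by (simp add: radon_prob_def)
  let ?C = "cylinder K f"
  define bad where "bad l j \<longleftrightarrow> j \<in> J \<and>
    measure M (sym_diff A0 (A j) \<inter> ?C l) \<le> d * measure M (?C l)" for l j
  \<comment> \<open>The minimal bad cylinders are pairwise disjoint, so copying \<open>A (h l)\<close> on each of them is consistent.\<close>
  define L where "L = {l. (\<exists>j. bad l j) \<and> (\<forall>n<length l. \<nexists>j. bad (take n l) j)}"
  define h where "h l = (SOME j. bad l j)" for l
  \<comment> \<open>\<open>far\<close> covers only finite unions, hence the cut-off at length
    \<open>N\<close>, which leaves finitely many words; \<open>N\<close> tends to infinity at the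
    end.\<close>
  define W where "W N = \<Union>(?C ` {l \<in> L. length l \<le> N})" for N
  have h: "bad l (h l)" if "l \<in> L" for l
    using that unfolding L_def h_def by (auto intro: someI)
  have setsC: "?C l \<in> sets M" for l
    using clopenin_cylinder[OF f] radon_prob_openin_sets[OF M] by blast
  have setsA: "A0 \<in> sets M" "j \<in> J \<Longrightarrow> A j \<in> sets M" for j
    using A0 A radon_prob_openin_sets[OF M] by blast+
  have fin: "finite {l \<in> L. length l \<le> N}" for N
  proof -
    have "finite {l. set l \<subseteq> (UNIV::bool set) \<and> length l \<le> N}"
      by (rule finite_lists_length_le) simp
    then show ?thesis by (rule rev_finite_subset) auto
  qed
  have setsW: "W N \<in> sets M" for N
    unfolding W_def using fin setsC by (intro sets.finite_UN) auto
  \<comment> \<open>The words of two cylinders through \<open>y\<close> are prefixes of one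
    sequence; if they differed, the shorter would be a bad proper prefix of the longer, against
    minimality.\<close>
  have disj: "l = l'" if l: "l \<in> L" "l' \<in> L" "y \<in> ?C l" "y \<in> ?C l'" for l l' y
  proof (rule ccontr)
    assume "l \<noteq> l'"
    have eq: "l = map (f y) [0..<length l]" "l' = map (f y) [0..<length l']"
      using l mem_cylinder_iff by metis+
    have tk: "take a (map (f y) [0..<b]) = map (f y) [0..<a]" if "a < b" for a b
      using that by (simp add: take_map)
    from \<open>l \<noteq> l'\<close> eq consider "length l < length l'" | "length l' < length l"
      by (metis nat_neq_iff)
    then show False
    proof cases
      case 1
      then have "take (length l) l' = l" using tk eq by metis
      with 1 l show False by (auto simp: L_def)
    next
      case 2
      then have "take (length l') l = l'" using tk eq by metis
      with 2 l show False by (auto simp: L_def)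
    qed
  qed
  have bound: "e \<le> d + (1 - measure M (W N))" for N
  proof -
    let ?L = "{l \<in> L. length l \<le> N}"
    let ?E = "\<Union>(V, j)\<in>(\<lambda>l. (?C l, h l)) ` ?L. V \<inter> A j"
    have E: "?E = (\<Union>l\<in>?L. ?C l \<inter> A (h l))" by auto
    have hJ: "h l \<in> J" if "l \<in> L" for l using h[OF that] by (simp add: bad_def)
    have setsD: "sym_diff A0 (A (h l)) \<inter> ?C l \<in> sets M" if "l \<in> L" for l
      using setsA setsC hJ[OF that] by auto
    have "e \<le> measure M (sym_diff A0 ?E)"
      using fin hJ by (intro far) auto
    also have "\<dots> \<le> measure M ((\<Union>l\<in>?L. sym_diff A0 (A (h l)) \<inter> ?C l) \<union> (space M - W N))"
    proof (rule finite_measure_mono)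
      show "sym_diff A0 ?E \<subseteq> (\<Union>l\<in>?L. sym_diff A0 (A (h l)) \<inter> ?C l) \<union> (space M - W N)"
      proof
        fix y assume y: "y \<in> sym_diff A0 ?E"
        then have "y \<in> space M"
          using sets.sets_into_space[OF setsA(1)] sets.sets_into_space[OF setsC] unfolding E by blast
        \<comment> \<open>By disjointness exactly one cylinder from \<open>?L\<close> contains a
          given point of \<open>W N\<close>, and on it the spliced set agrees with
          \<open>A (h l)\<close>.\<close>
        moreover have "y \<in> (\<Union>l\<in>?L. sym_diff A0 (A (h l)) \<inter> ?C l)" if "y \<in> W N"
        proof -
          obtain l where l: "l \<in> ?L" "y \<in> ?C l" using \<open>y \<in> W N\<close> by (auto simp: W_def)
          then have "y \<in> ?E \<longleftrightarrow> y \<in> A (h l)"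
            unfolding E using disj by blast
          with y l show ?thesis by blast
        qed
        ultimately show "y \<in> (\<Union>l\<in>?L. sym_diff A0 (A (h l)) \<inter> ?C l) \<union> (space M - W N)" by blast
      qed
      show "(\<Union>l\<in>?L. sym_diff A0 (A (h l)) \<inter> ?C l) \<union> (space M - W N) \<in> sets M"
        using fin setsD setsW by (intro sets.Un sets.finite_UN sets.compl_sets) auto
    qed
    also have "\<dots> \<le> measure M (\<Union>l\<in>?L. sym_diff A0 (A (h l)) \<inter> ?C l) + measure M (space M - W N)"
      using fin setsD setsW by (intro measure_Un_le sets.finite_UN sets.compl_sets) auto
    also have "measure M (space M - W N) = 1 - measure M (W N)"
      by (rule prob_compl[OF setsW])
    also have "measure M (\<Union>l\<in>?L. sym_diff A0 (A (h l)) \<inter> ?C l)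
        \<le> (\<Sum>l\<in>?L. measure M (sym_diff A0 (A (h l)) \<inter> ?C l))"
      using fin setsD by (intro measure_UNION_le) auto
    also have "\<dots> \<le> (\<Sum>l\<in>?L. d * measure M (?C l))"
      using h by (intro sum_mono) (auto simp: bad_def)
    also have "\<dots> = d * measure M (W N)"
    proof -
      have "disjoint_family_on ?C ?L"
        using disj by (auto simp: disjoint_family_on_def)
      then have "measure M (W N) = (\<Sum>l\<in>?L. measure M (?C l))"
        unfolding W_def using fin setsC by (intro finite_measure_finite_Union) auto
      then show ?thesis by (simp add: sum_distrib_left)
    qed
    also have "\<dots> \<le> d" using d by (simp add: mult_left_le)
    finally show ?thesis by simp
  qed
  have UW: "(\<Union>N. W N) = \<Union>{?C l | l. \<exists>j. bad l j}"
  proof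
    show "(\<Union>N. W N) \<subseteq> \<Union>{?C l | l. \<exists>j. bad l j}" by (auto simp: W_def L_def)
    show "\<Union>{?C l | l. \<exists>j. bad l j} \<subseteq> (\<Union>N. W N)"
    proof
      fix y assume "y \<in> \<Union>{?C l | l. \<exists>j. bad l j}"
      then obtain l where l: "\<exists>j. bad l j" "y \<in> ?C l" by blast
      \<comment> \<open>The shortest bad prefix of \<open>l\<close> belongs to \<open>L\<close> and
        its cylinder contains that of \<open>l\<close>, so keeping only minimal words loses no
        points.\<close>
      define n where "n = (LEAST n. \<exists>j. bad (take n l) j)"
      have n: "\<exists>j. bad (take n l) j"
        unfolding n_def by (rule LeastI[of _ "length l"]) (use l in simp)
      have min: "\<nexists>j. bad (take k l) j" if "k < n" for k
        using that not_less_Least unfolding n_def by blast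
      have "take n l \<in> L"
        unfolding L_def using n min by (auto simp: min_def)
      moreover have "y \<in> ?C (take n l)"
        using l(2) by (auto simp: cylinder_def)
      ultimately show "y \<in> (\<Union>N. W N)" by (auto simp: W_def)
    qed
  qed
  have "incseq W" unfolding incseq_def W_def by force
  then have "(\<lambda>N. measure M (W N)) \<longlonglongrightarrow> measure M (\<Union>N. W N)"
    using setsW by (intro finite_Lim_measure_incseq) auto
  then have "(\<lambda>N. d + (1 - measure M (W N))) \<longlonglongrightarrow> d + (1 - measure M (\<Union>N. W N))"
    by (intro tendsto_intros)
  then have "e \<le> d + (1 - measure M (\<Union>N. W N))"
    by (rule LIMSEQ_le_const) (use bound in blast)
  also have "1 - measure M (\<Union>N. W N) = measure M (space M - (\<Union>N. W N))"
    using setsW by (intro prob_compl[symmetric]) auto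
  finally show ?thesis
    unfolding UW sp bad_def by (simp add: Bex_def)
qed

subsection \<open>Non-separable measures on fibers\<close>

text \<open>A subset of \<open>T\<close> is compact in \<open>T\<close> exactly when it is compact
  in \<open>K\<close>, so inner regularity is inherited.\<close>

lemma radon_prob_restrict_space:
  assumes M: "radon_prob K M" and T: "closedin K T" "emeasure M T = 1"
  shows "radon_prob (subtopology K T) (restrict_space M T)"
proof -
  have TM: "T \<in> sets M" using radon_prob_closedin_sets[OF M T(1)] .
  have sp: "space M = topspace K" and sM: "sets M = sigma_sets (topspace K) {U. openin K U}"
    using M by (auto simp: radon_prob_def)
  have TK: "T \<subseteq> topspace K" "topspace K \<inter> T = T" using closedin_subset[OF T(1)] by auto
  have opens: "{U. openin (subtopology K T) U} = (\<inter>) T ` {U. openin K U}"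
    by (auto simp: openin_subtopology image_iff Int_commute)
  have "sets (restrict_space M T) = sigma_sets T {U. openin (subtopology K T) U}"
    unfolding sets_restrict_space opens sM using TM TK sM by (intro sigma_sets_Int) auto
  moreover have "emeasure (restrict_space M T) A =
      (SUP C\<in>{C. compactin (subtopology K T) C \<and> C \<subseteq> A}. emeasure (restrict_space M T) C)"
    if A: "A \<in> sets (restrict_space M T)" for A
  proof -
    have A': "A \<subseteq> T" "A \<in> sets M"
      using A TM sets_restrict_space_iff[of T M A] by auto
    have em: "emeasure (restrict_space M T) C = emeasure M C" if "C \<subseteq> T" for C
      using TM that by (intro emeasure_restrict_space) auto
    have "{C. compactin (subtopology K T) C \<and> C \<subseteq> A} = {C. compactin K C \<and> C \<subseteq> A}"
      using A' by (auto simp: compactin_subtopology)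
    moreover have "emeasure M A = (SUP C\<in>{C. compactin K C \<and> C \<subseteq> A}. emeasure M C)"
      using M A' by (simp add: radon_prob_def)
    moreover have "(SUP C\<in>{C. compactin K C \<and> C \<subseteq> A}. emeasure (restrict_space M T) C) =
        (SUP C\<in>{C. compactin K C \<and> C \<subseteq> A}. emeasure M C)"
      using em A' by (intro SUP_cong) auto
    ultimately show ?thesis using em[OF A'(1)] by simp
  qed
  moreover have "space (restrict_space M T) = T"
    using TK sp by (auto simp: space_restrict_space)
  ultimately show ?thesis
    unfolding radon_prob_def using prob_space_restrict_space[OF TM T(2)] TK by simp
qed

text \<open>By pigeonhole a countable approximating family would offer the same set within
  \<open>d/2\<close> of \<open>S i\<close> and of \<open>S j\<close> for two distinct indices,
  against their distance of at least \<open>d\<close>.\<close>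

lemma not_separable_measureI:
  assumes J: "uncountable J" and S: "\<And>i. i \<in> J \<Longrightarrow> S i \<in> sets N" and d: "0 < d"
    and far: "\<And>i j. i \<in> J \<Longrightarrow> j \<in> J \<Longrightarrow> i \<noteq> j \<Longrightarrow> ennreal d \<le> emeasure N (sym_diff (S i) (S j))"
  shows "\<not> separable_measure N"
proof
  assume "separable_measure N"
  then obtain \<E> where \<E>: "countable \<E>" "approximates \<E> N"
    unfolding separable_measure_iff by blast
  let ?c = "emeasure (completion N)"
  have "\<exists>E\<in>\<E>. ?c (sym_diff (S i) E) < ennreal (d/2)" if "i \<in> J" for i
  proof -
    have "(INF E\<in>\<E>. ?c (sym_diff (S i) E)) = 0"
      using \<E>(2) S[OF that] unfolding approximates_def by (metis sets_completionI_sets)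
    then have "(INF E\<in>\<E>. ?c (sym_diff (S i) E)) < ennreal (d/2)"
      using d by simp
    then show ?thesis unfolding INF_less_iff .
  qed
  then obtain E where E: "\<And>i. i \<in> J \<Longrightarrow> E i \<in> \<E>"
    "\<And>i. i \<in> J \<Longrightarrow> ?c (sym_diff (S i) (E i)) < ennreal (d/2)"
    by metis
  have "countable (E ` J)"
    using E(1) \<E>(1) by (meson countable_subset image_subsetI)
  then have "\<not> inj_on E J"
    using J countable_image_inj_on by blast
  then obtain i j where ij: "i \<in> J" "j \<in> J" "i \<noteq> j" "E i = E j"
    unfolding inj_on_def by blast
  have sets: "S i \<in> sets (completion N)" "S j \<in> sets (completion N)" "E i \<in> sets (completion N)"
    using S ij E \<E>(2) by (auto simp: approximates_def)
  have "ennreal d \<le> emeasure N (sym_diff (S i) (S j))"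
    using far ij by blast
  also have "\<dots> = ?c (sym_diff (S i) (S j))"
    using S ij by simp
  also have "\<dots> \<le> ?c (sym_diff (S i) (E i) \<union> sym_diff (S j) (E j))"
    using sets ij by (intro emeasure_mono) (auto intro!: sets.Un sets.Diff)
  also have "\<dots> \<le> ?c (sym_diff (S i) (E i)) + ?c (sym_diff (S j) (E j))"
    using sets ij by (intro emeasure_subadditive) (auto intro!: sets.Un sets.Diff)
  also have "\<dots> < ennreal (d/2) + ennreal (d/2)"
    by (rule add_strict_mono[OF E(2)[OF ij(1)] E(2)[OF ij(2)]])
  also have "\<dots> = ennreal d" using d by (simp flip: ennreal_plus)
  finally show False by simp
qed

text \<open>All sets involved are clopen, so lower bounds on the relative measures in
  \<open>V n\<close> pass to a cluster charge and thence to its Radon extension. This gives both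
  concentration on the intersection and separation of the sets \<open>A i\<close>.\<close>

lemma carries_nonseparable_measure_Inter:
  fixes V :: "nat \<Rightarrow> 'a set"
  assumes K: "compact_space K" "Hausdorff_space K" "K dim_le 0" and M: "radon_prob K M"
    and V: "\<And>n. clopenin K (V n)" "decseq V" "\<And>n. measure M (V n) \<noteq> 0"
    and J: "uncountable J" and A: "\<And>i. i \<in> J \<Longrightarrow> clopenin K (A i)" and d: "0 < d"
    and far: "\<And>i j n. i \<in> J \<Longrightarrow> j \<in> J \<Longrightarrow> i \<noteq> j \<Longrightarrow>
      d * measure M (V n) \<le> measure M (sym_diff (A i) (A j) \<inter> V n)"
  shows "carries_nonseparable_measure (subtopology K (\<Inter>n. V n))"
proof -
  interpret prob_space M using M by (simp add: radon_prob_def)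
  have setsM: "C \<in> sets M" if "clopenin K C" for C
    using that radon_prob_openin_sets[OF M] by blast
  have pos: "0 < measure M (V n)" for n
    using V(3)[of n] by (simp add: zero_less_measure_iff)
  define m where "m n S = measure M (S \<inter> V n) / measure M (V n)" for n S
  have "clopen_charge K (m n)" for n
    unfolding clopen_charge_def
  proof (intro conjI allI impI)
    fix B C assume BC: "clopenin K B \<and> clopenin K C \<and> B \<inter> C = {}"
    then have "measure M ((B \<inter> V n) \<union> (C \<inter> V n)) = measure M (B \<inter> V n) + measure M (C \<inter> V n)"
      using setsM V(1)[of n] by (intro finite_measure_Union) auto
    then show "m n (B \<union> C) = m n B + m n C"
      by (simp add: m_def Int_Un_distrib2 add_divide_distrib)
  next
    have "topspace K \<inter> V n = V n" using V(1)[of n] openin_subset by blast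
    then show "m n (topspace K) = 1" using V(3)[of n] by (simp add: m_def)
  qed (simp add: m_def)
  then obtain l where l: "clopen_charge K l"
    "\<And>S c. clopenin K S \<Longrightarrow> (\<forall>\<^sub>F n in sequentially. c \<le> m n S) \<Longrightarrow> c \<le> l S"
    using clopen_charge_cluster_point by metis
  obtain N where N: "radon_prob K N" "\<And>S. clopenin K S \<Longrightarrow> measure N S = l S"
    using clopen_charge_radon_extension[OF K l(1)] by metis
  interpret N: prob_space N using N by (simp add: radon_prob_def)
  let ?T = "\<Inter>n. V n"
  have T: "closedin K ?T" using V(1) by (intro closedin_INT) auto
  have V1: "measure N (V k) = 1" for k
  proof (rule antisym)
    \<comment> \<open>From stage \<open>k\<close> on, \<open>V n\<close> lies inside
      \<open>V k\<close>, which therefore has full relative measure; the lower bound 1 is enough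
      because \<open>N\<close> is a probability.\<close>
    have "m n (V k) = 1" if "k \<le> n" for n
    proof -
      have "V k \<inter> V n = V n" using decseqD[OF V(2) that] by blast
      then show ?thesis using V(3)[of n] by (simp add: m_def)
    qed
    then have "\<forall>\<^sub>F n in sequentially. 1 \<le> m n (V k)"
      by (intro eventually_sequentiallyI[of k]) simp
    then show "1 \<le> measure N (V k)" using l(2) N(2) V(1) by metis
  qed simp
  have "(\<lambda>n. measure N (V n)) \<longlonglongrightarrow> measure N ?T"
    using V radon_prob_openin_sets[OF N(1)] by (intro N.finite_Lim_measure_decseq) auto
  then have "measure N ?T = 1"
    using V1 LIMSEQ_unique[OF _ tendsto_const] by auto
  then have T1: "emeasure N ?T = 1" by (simp add: N.emeasure_eq_measure)
  have TN: "?T \<in> sets N" using radon_prob_closedin_sets[OF N(1) T] .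
  have "\<not> separable_measure (restrict_space N ?T)"
  proof (rule not_separable_measureI[OF J _ d])
    fix i assume i: "i \<in> J"
    then have Ai: "A i \<in> sets N" using A radon_prob_openin_sets[OF N(1)] by blast
    then show "?T \<inter> A i \<in> sets (restrict_space N ?T)"
      by (simp add: sets_restrict_space)
    fix j assume j: "j \<in> J" "i \<noteq> j"
    then have Aj: "A j \<in> sets N" using A radon_prob_openin_sets[OF N(1)] by blast
    have clo: "clopenin K (sym_diff (A i) (A j))"
      using A[OF i] A[OF j(1)] by (auto intro!: openin_diff closedin_diff)
    have "d \<le> m n (sym_diff (A i) (A j))" for n
      using far[OF i j, of n] pos[of n] by (simp add: m_def pos_le_divide_eq)
    then have "d \<le> measure N (sym_diff (A i) (A j))"
      using l(2)[OF clo, of d] N(2)[OF clo] by simp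
    then have "ennreal d \<le> emeasure N (sym_diff (A i) (A j))"
      by (simp add: N.emeasure_eq_measure ennreal_leI)
    \<comment> \<open>\<open>N\<close> is concentrated on \<open>?T\<close>, so cutting the
      symmetric difference down to \<open>?T\<close> keeps its measure.\<close>
    also have "\<dots> = emeasure N (sym_diff (A i) (A j) \<inter> ?T)"
    proof (rule emeasure_eq_AE)
      have "AE x in N. x \<in> ?T"
        using N.prob_eq_1[OF TN] \<open>measure N ?T = 1\<close> by simp
      then show "AE x in N. (x \<in> sym_diff (A i) (A j)) = (x \<in> sym_diff (A i) (A j) \<inter> ?T)"
        by eventually_elim simp
    qed (use Ai Aj TN in auto)
    also have "\<dots> = emeasure (restrict_space N ?T) (sym_diff (A i) (A j) \<inter> ?T)"
      using TN by (intro emeasure_restrict_space[symmetric]) auto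
    also have "sym_diff (A i) (A j) \<inter> ?T = sym_diff (?T \<inter> A i) (?T \<inter> A j)" by blast
    finally show "ennreal d \<le> emeasure (restrict_space N ?T) (sym_diff (?T \<inter> A i) (?T \<inter> A j))" .
  qed
  then show ?thesis
    unfolding carries_nonseparable_measure_def
    using radon_prob_restrict_space[OF N(1) T T1] by blast
qed

theorem theorem2p4:
  fixes K :: "'a topology" and \<mu> :: "'a measure" and f :: "'a \<Rightarrow> nat \<Rightarrow> bool"
  assumes "omega1_precaliber_measure_algebras TYPE((nat + 'a) set set)"
    and "compact_space K" and "Hausdorff_space K" and "K dim_le 0"
    and "radon_prob K \<mu>" and "\<not> separable_measure \<mu>"
    and "continuous_map K cantor_space f"
  shows "\<exists>t. carries_nonseparable_measure (subtopology K {x \<in> topspace K. f x = t})"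
proof -
  let ?C = "cylinder K f"
  interpret prob_space \<mu> using assms(5) by (simp add: radon_prob_def)
  obtain e where e: "0 < e" "\<And>\<E>. countable \<E> \<Longrightarrow> \<E> \<subseteq> sets \<mu> \<Longrightarrow>
      \<exists>A. clopenin K A \<and> (\<forall>E\<in>\<E>. e \<le> measure \<mu> (sym_diff A E))"
    using nonseparable_clopen_far[OF assms(2-6)] by metis
  obtain I :: "nat set set" and R where IR: "uncountable I" "wf R"
    "\<And>i. i \<in> I \<Longrightarrow> countable {j. (j, i) \<in> R}"
    "\<And>i j. i \<in> I \<Longrightarrow> j \<in> I \<Longrightarrow> i \<noteq> j \<Longrightarrow> (i, j) \<in> R \<or> (j, i) \<in> R" "R \<subseteq> I \<times> I"
    using uncountable_wf_countable_segments by metis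
  have C: "countable (range ?C)" "range ?C \<subseteq> sets \<mu>"
    using clopenin_cylinder[OF assms(7)] radon_prob_openin_sets[OF assms(5)] by auto
  obtain A where A: "\<And>i. i \<in> I \<Longrightarrow> clopenin K (A i)"
    "\<And>i F. i \<in> I \<Longrightarrow> finite F \<Longrightarrow> F \<subseteq> range ?C \<times> {j. (j, i) \<in> R} \<Longrightarrow>
      e \<le> measure \<mu> (sym_diff (A i) (\<Union>(V, j)\<in>F. V \<inter> A j))"
    using far_clopen_family[OF assms(5) C e(2) IR(2,3,5)] by metis
  \<comment> \<open>Only open cylinders are removed, so \<open>B i\<close> is closed, as the
    compactness argument requires; the proportion \<open>e/2\<close> leaves the other half of
    \<open>e\<close> for the measure of \<open>B i\<close>.\<close>
  define B where "B i = topspace K - \<Union>{?C l | l. \<exists>j\<in>{j. (j, i) \<in> R}.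
      measure \<mu> (sym_diff (A i) (A j) \<inter> ?C l) \<le> e/2 * measure \<mu> (?C l)}" for i
  have clB: "closedin K (B i)" for i
    unfolding B_def using clopenin_cylinder[OF assms(7)]
    by (intro closedin_diff closedin_topspace openin_Union) blast
  have posB: "measure \<mu> (B i) \<noteq> 0" if i: "i \<in> I" for i
  proof -
    have "clopenin K (A j)" if "j \<in> {j. (j, i) \<in> R}" for j
      using that IR(5) A(1) by blast
    then have "e \<le> e/2 + measure \<mu> (B i)"
      unfolding B_def using e(1)
      by (intro measure_outside_approximating_cylinders[OF assms(5,7) A(1)[OF i]] A(2)[OF i]) auto
    then show ?thesis using e(1) by simp
  qed
  \<comment> \<open>The precaliber hypothesis concerns points of type
    \<open>(nat + 'a) set set\<close>; this map embeds the points of \<open>K\<close> there.\<close>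
  have inj: "inj (\<lambda>x::'a. {{Inr x :: nat + 'a}})" by (simp add: inj_def)
  obtain J x where J: "J \<subseteq> I" "uncountable J" "x \<in> topspace K" "\<And>i. i \<in> J \<Longrightarrow> x \<in> B i"
    by (rule omega1_precaliber_closed_family[OF assms(1) inj assms(2,3,5) IR(1), of B])
      (use clB posB in auto)
  \<comment> \<open>The cylinders given by the first \<open>n\<close> values of \<open>f x\<close>;
    they shrink to the fiber through \<open>x\<close>.\<close>
  define V where "V n = ?C (map (f x) [0..<n])" for n
  have xV: "x \<in> V n" for n using J(3) by (simp add: V_def cylinder_def)
  \<comment> \<open>If the inequality failed, \<open>V n\<close> would be one of the cylinders
    removed from \<open>B i\<close>, yet it contains \<open>x\<close>.\<close>
  have far': "e/2 * measure \<mu> (V n) < measure \<mu> (sym_diff (A i) (A j) \<inter> V n)"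
    if "i \<in> J" "(j, i) \<in> R" for i j n
  proof (rule ccontr)
    assume "\<not> ?thesis"
    then have "x \<notin> B i" unfolding B_def using xV[of n] that(2) unfolding V_def by force
    then show False using J(4) that(1) by blast
  qed
  \<comment> \<open>\<open>R\<close> compares any two distinct indices, and the symmetric difference
    does not depend on their order.\<close>
  have far: "e/2 * measure \<mu> (V n) < measure \<mu> (sym_diff (A i) (A j) \<inter> V n)"
    if "i \<in> J" "j \<in> J" "i \<noteq> j" for i j n
  proof -
    have "(i, j) \<in> R \<or> (j, i) \<in> R" using IR(4) J(1) that by blast
    then show ?thesis
      using far'[of i j n] far'[of j i n] that by (auto simp: Un_commute)
  qed
  have "carries_nonseparable_measure (subtopology K (\<Inter>n. V n))"
  proof (rule carries_nonseparable_measure_Inter[OF assms(2-5)])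
    show "clopenin K (V n)" for n
      unfolding V_def by (rule clopenin_cylinder[OF assms(7)])
    show "decseq V" by (auto simp: decseq_def V_def cylinder_def)
    \<comment> \<open>A null \<open>V n\<close> would contradict the strict inequality
      \<open>far\<close> for two distinct indices, which the uncountable \<open>J\<close>
      provides.\<close>
    show "measure \<mu> (V n) \<noteq> 0" for n
    proof
      assume 0: "measure \<mu> (V n) = 0"
      obtain i where i: "i \<in> J" using J(2) by (metis countable_empty equals0I)
      have "uncountable (J - {i})" using J(2) by simp
      then obtain j where j: "j \<in> J" "i \<noteq> j" by (metis countable_empty equals0I Diff_iff singletonI)
      have "clopenin K (A i)" "clopenin K (A j)" "V n \<in> sets \<mu>"
        using i j A J(1) C(2) by (auto simp: V_def)
      then have "measure \<mu> (sym_diff (A i) (A j) \<inter> V n) \<le> measure \<mu> (V n)"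
        by (intro finite_measure_mono) auto
      then show False using far[OF i j, of n] 0 by simp
    qed
    show "uncountable J" "0 < e/2" using J e by auto
    show "clopenin K (A i)" if "i \<in> J" for i using that A J by blast
    show "e/2 * measure \<mu> (V n) \<le> measure \<mu> (sym_diff (A i) (A j) \<inter> V n)"
      if "i \<in> J" "j \<in> J" "i \<noteq> j" for i j n
      using far[OF that, of n] by simp
  qed
  \<comment> \<open>Agreement with \<open>f x\<close> below \<open>n\<close> for every
    \<open>n\<close> is equality with \<open>f x\<close>.\<close>
  moreover have "(\<Inter>n. V n) = {y \<in> topspace K. f y = f x}"
    by (auto simp: V_def cylinder_def fun_eq_iff intro: lessI)
  ultimately show ?thesis by auto
qed

end
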